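(* Let $\mathbb{F}$ be a field, let $m,n,d$ be positive integers, and let $M(\lambda)\in\mathbb{F}[\lambda]^{m\times(m+n)}$ be a polynomial matrix of degree at most $d$. Let $d_1,\dots,d_m$ be its row degrees and $M_{hr}$ its highest-row-degree coefficient matrix. Let $S_k$, $k=1,2,\dots$, be the Sylvester matrices of $M(\lambda)$, let $r_k$ and $n_k$ be the rank and the right nullity of $S_k$, respectively, and put $r_0=n_0=0$. Let $d'$ be the smallest index $k$ for which $n_{k+1}=n_k+n$, or equivalently $r_{k+1}=r_k+m$. Then $M(\lambda)$ is a minimal basis if and only if $$\operatorname{rank} M_{hr}=m\qquad\text{and}\qquad r_{d'}-m\,d'=\sum_{i=1}^m d_i .$$
   Context: Sylvester matrices: write $M(\lambda)=M_0+M_1\lambda+\cdots+M_d\lambda^d$ with $M_i\in\mathbb{F}^{m\times(m+n)}$ ($M_d=0$ is allowed). For $k\ge 1$, $S_k\in\mathbb{F}^{(k+d)m\times k(m+n)}$ is the block matrix with $k+d$ block rows and $k$ block columns whose $(i,j)$ block (of size $m\times(m+n)$) is $M_{i-j}$ if $0\le i-j\le d$ and $0$ otherwise. The right nullity is the dimension of the right null space, so $r_k+n_k=k(m+n)$. The degree of a polynomial vector is the highest degree of its entries; the row degrees of $M(\lambda)$ are the degrees of its rows. $M_{hr}\in\mathbb{F}^{m\times(m+n)}$ is the constant matrix whose $i$th row is the vector coefficient of $\lambda^{d_i}$ in the $i$th row of $M(\lambda)$ (a zero row of $M(\lambda)$ gives a zero row of $M_{hr}$, and its degree may be taken as $0$).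 A minimal basis of a subspace $\mathcal V\subseteq\mathbb{F}(\lambda)^{q}$ (over the field $\mathbb{F}(\lambda)$) is a basis of $\mathcal V$ consisting of polynomial vectors whose sum of degrees is minimal among all bases of $\mathcal V$ consisting of polynomial vectors. A polynomial matrix with fewer rows than columns is called a minimal basis if its rows form a minimal basis of the subspace over $\mathbb{F}(\lambda)$ that they span (in particular the rows are linearly independent over $\mathbb{F}(\lambda)$). The index $d'$ exists whenever $M(\lambda)$ has full row rank over $\mathbb{F}(\lambda)$, which is implied by $\operatorname{rank}M_{hr}=m$; if no such index exists, the second condition is regarded as not satisfied. *)

theory Defs
  imports
    "Jordan_Normal_Form.Matrix_Kernel"
    "Jordan_Normal_Form.DL_Rank"
    "HOL-Computational_Algebra.Normalized_Fraction"
begin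

text \<open>
  Polynomial vectors and matrices have entries in the type \<open>'a poly\<close>, where \<open>'a\<close> is the field;
  the field of rational functions is \<open>'a poly fract\<close>. Row, column and block indices start at 0.
\<close>

text \<open>The zero vector gets degree 0.\<close>

definition vec_degree :: "'a::zero poly vec \<Rightarrow> nat" where
  "vec_degree v = Max (insert 0 {degree (v $ j) | j. j < dim_vec v})"

definition row_degree :: "'a::zero poly mat \<Rightarrow> nat \<Rightarrow> nat" where
  "row_degree M i = vec_degree (row M i)"

definition highest_row_degree_mat :: "'a::zero poly mat \<Rightarrow> 'a mat" where
  "highest_row_degree_mat M =
     mat (dim_row M) (dim_col M) (\<lambda>(i, j). coeff (M $$ (i, j)) (row_degree M i))"

definition coeff_mat :: "'a::zero poly mat \<Rightarrow> nat \<Rightarrow> 'a mat" where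
  "coeff_mat M l = map_mat (\<lambda>p. coeff p l) M"

text \<open>
  Entry \<open>(a, b)\<close> lies in block row \<open>a div dim_row M\<close> and block column \<open>b div dim_col M\<close>;
  its position inside that block is given by the remainders.
\<close>

definition sylvester_mat :: "nat \<Rightarrow> 'a::zero poly mat \<Rightarrow> nat \<Rightarrow> 'a mat" where
  "sylvester_mat d M k =
     mat ((k + d) * dim_row M) (k * dim_col M) (\<lambda>(a, b).
       let i = a div dim_row M; j = b div dim_col M
       in if j \<le> i \<and> i - j \<le> d
          then coeff_mat M (i - j) $$ (a mod dim_row M, b mod dim_col M)
          else 0)"

definition mat_rank :: "'a::field mat \<Rightarrow> nat" where
  "mat_rank A = vec_space.rank (dim_row A) A"

definition sylvester_rank :: "nat \<Rightarrow> 'a::field poly mat \<Rightarrow> nat \<Rightarrow> nat" where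
  "sylvester_rank d M k = (if k = 0 then 0 else mat_rank (sylvester_mat d M k))"

definition sylvester_nullity :: "nat \<Rightarrow> 'a::field poly mat \<Rightarrow> nat \<Rightarrow> nat" where
  "sylvester_nullity d M k = (if k = 0 then 0 else kernel_dim (sylvester_mat d M k))"

text \<open>
  A basis of a subspace \<open>W\<close> of the space of vectors of length \<open>q\<close> over the rational functions
  that consists of polynomial vectors. It is a list without repetitions, so that a matrix with two
  equal rows does not qualify.
\<close>

definition polynomial_basis ::
  "nat \<Rightarrow> 'a::field poly fract vec set \<Rightarrow> 'a poly vec list \<Rightarrow> bool" where
  "polynomial_basis q W vs \<longleftrightarrow>
     set vs \<subseteq> carrier_vec q \<and> distinct vs \<and>
     vectorspace.basis class_ring (module_vec TYPE('a poly fract) q\<lparr>carrier := W\<rparr>)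
       (map_vec to_fract ` set vs)"

definition minimal_basis_of ::
  "nat \<Rightarrow> 'a::field poly fract vec set \<Rightarrow> 'a poly vec list \<Rightarrow> bool" where
  "minimal_basis_of q W vs \<longleftrightarrow>
     polynomial_basis q W vs \<and>
     (\<forall>ws. polynomial_basis q W ws \<longrightarrow>
        sum_list (map vec_degree vs) \<le> sum_list (map vec_degree ws))"

definition minimal_basis_mat :: "'a::field poly mat \<Rightarrow> bool" where
  "minimal_basis_mat M \<longleftrightarrow>
     dim_row M < dim_col M \<and>
     minimal_basis_of (dim_col M)
       (LinearCombinations.module.span class_ring (module_vec TYPE('a poly fract) (dim_col M))
          (map_vec to_fract ` set (rows M)))
       (rows M)"

end

theory Submission
  imports Defs
begin

text \<open>
  The matrix \<open>S\<^sub>k\<close> represents \<open>p \<mapsto> M p\<close> on polynomial vectors with \<open>deg p < k\<close>, whose image lies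
  in the space \<open>D\<^sub>k\<close> of vectors \<open>f\<close> with \<open>deg f\<^sub>i < k + d\<^sub>i\<close>, of dimension \<open>k m + \<Sum> d\<^sub>i\<close>. The
  increments of the nullities are the dimensions of the spaces of coefficients of \<open>\<lambda>\<^sup>k\<close> of kernel vectors
  of degree at most \<open>k\<close>; these spaces increase with \<open>k\<close>. Hence the rank grows by exactly \<open>m\<close>
  between \<open>d'\<close> and any later index with increment \<open>n\<close>, and the second condition says that the
  image of \<open>S\<^sub>k\<close> is all of \<open>D\<^sub>k\<close>.

  If \<open>M\<close> is a minimal basis, no row can be exchanged for a combination of rows of smaller degree. This
  makes \<open>M\<^sub>h\<^sub>r\<close> of full rank and \<open>M\<close> saturated: if \<open>g\<close> divides \<open>y M\<close>, it divides \<open>y\<close>. A saturated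
  matrix has a polynomial right inverse, and full rank of \<open>M\<^sub>h\<^sub>r\<close> then gives the full image for large
  \<open>k\<close>. Conversely, a full image yields a right inverse of \<open>M\<close>, so every polynomial basis of the row
  space has the form \<open>T M\<close> with \<open>T\<close> polynomial. As \<open>det T \<noteq> 0\<close>, some permutation \<open>\<pi>\<close> has only nonzero
  entries \<open>T (i, \<pi> i)\<close>, and by the full rank of \<open>M\<^sub>h\<^sub>r\<close> row \<open>i\<close> of \<open>T M\<close> has at least the degree of
  row \<open>\<pi> i\<close> of \<open>M\<close>.
\<close>

section \<open>Dimensions of subspaces and matrix rank\<close>

definition subspace_dim_vec :: "nat \<Rightarrow> 'a::field vec set \<Rightarrow> nat" where
  "subspace_dim_vec n U = vectorspace.dim class_ring (module_vec TYPE('a) n\<lparr>carrier := U\<rparr>)"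

abbreviation vec_subspace :: "nat \<Rightarrow> 'a::field vec set \<Rightarrow> bool" where
  "vec_subspace n U \<equiv> subspace class_ring U (module_vec TYPE('a) n)"

lemma vec_subspaceI:
  fixes U :: "'a::field vec set"
  assumes "U \<subseteq> carrier_vec n" "0\<^sub>v n \<in> U"
    and "\<And>u v. u \<in> U \<Longrightarrow> v \<in> U \<Longrightarrow> u + v \<in> U"
    and "\<And>c u. u \<in> U \<Longrightarrow> c \<cdot>\<^sub>v u \<in> U"
  shows "vec_subspace n U"
  unfolding subspace_def submodule_def
  using assms vec_vs[where ?'a='a] vec_module[where ?'a='a]
  by (auto simp: module_vec_simps class_ring_simps)

lemma vec_subspaceD:
  fixes U :: "'a::field vec set"
  assumes "vec_subspace n U"
  shows "U \<subseteq> carrier_vec n" "0\<^sub>v n \<in> U"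
    and "\<And>u v. u \<in> U \<Longrightarrow> v \<in> U \<Longrightarrow> u + v \<in> U"
    and "\<And>c u. u \<in> U \<Longrightarrow> c \<cdot>\<^sub>v u \<in> U"
  using assms unfolding subspace_def submodule_def
  by (auto simp: module_vec_simps class_ring_simps)

lemma vec_subspace_vs:
  assumes "vec_subspace n (U :: 'a::field vec set)"
  shows "vectorspace class_ring (module_vec TYPE('a) n\<lparr>carrier := U\<rparr>)"
  using vectorspace.subspace_is_vs[OF vec_vs assms] .

text \<open>Independence within \<open>U\<close> and in the ambient space agree, so the ambient
  dimension bounds the size of independent subsets of \<open>U\<close>, and a maximal one is a
  basis.\<close>

lemma vec_subspace_basis:
  assumes "vec_subspace n (U :: 'a::field vec set)"
  obtains B where "finite B" "vectorspace.basis class_ring (module_vec TYPE('a) n\<lparr>carrier := U\<rparr>) B"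
    "\<not> module.lin_dep class_ring (module_vec TYPE('a) n) B" "B \<subseteq> U"
proof -
  interpret vec_space "TYPE('a)" n .
  note U = vec_subspaceD[OF assms]
  have sub: "submodule class_ring U V" using assms unfolding subspace_def by simp
  interpret W: vectorspace class_ring "vs U" by (rule vec_subspace_vs[OF assms])
  have li: "W.lin_dep S = lin_dep S" if "S \<subseteq> U" for S
    using span_li_not_depend(2)[OF that sub] by simp
  have "\<exists>A. finite A \<and> maximal A (\<lambda>S. S \<subseteq> U \<and> W.lin_indpt S)"
  proof (rule maximal_exists[where N = dim and B = "{}"])
    show "{} \<subseteq> U \<and> W.lin_indpt {}" unfolding W.lin_dep_def by auto
  next
    fix A assume "A \<subseteq> U \<and> W.lin_indpt A"
    then show "finite A \<and> card A \<le> dim"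
      using li[of A] li_le_dim[of A] U(1) by auto
  qed
  then obtain A where A: "finite A" "maximal A (\<lambda>S. S \<subseteq> carrier (vs U) \<and> W.lin_indpt S)" by auto
  have "W.basis A" using W.max_li_is_basis[OF A(2)] .
  then show ?thesis using that[OF A(1)] li[of A] unfolding W.basis_def by auto
qed

lemma vec_subspace_fin_dim:
  assumes "vec_subspace n (U :: 'a::field vec set)"
  shows "vectorspace.fin_dim class_ring (module_vec TYPE('a) n\<lparr>carrier := U\<rparr>)"
proof -
  obtain B where "finite B" "vectorspace.basis class_ring (module_vec TYPE('a) n\<lparr>carrier := U\<rparr>) B"
    using vec_subspace_basis[OF assms] by blast
  then show ?thesis
    unfolding vectorspace.fin_dim_def[OF vec_subspace_vs[OF assms]]
      vectorspace.basis_def[OF vec_subspace_vs[OF assms]] by auto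
qed

lemma vec_subspace_nested:
  assumes "vec_subspace n (U :: 'a::field vec set)" "vec_subspace n U'" "U \<subseteq> U'"
  shows "subspace class_ring U (module_vec TYPE('a) n\<lparr>carrier := U'\<rparr>)"
  using vectorspace.nested_subspaces[OF vec_vs assms(2,1,3)] .

lemma subspace_dim_vec_mono:
  assumes "vec_subspace n (U :: 'a::field vec set)" "vec_subspace n U'" "U \<subseteq> U'"
  shows "subspace_dim_vec n U \<le> subspace_dim_vec n U'"
  unfolding subspace_dim_vec_def
  using vectorspace.subspace_dim[OF vec_subspace_vs[OF assms(2)] vec_subspace_nested[OF assms]
      vec_subspace_fin_dim[OF assms(2)]] vec_subspace_fin_dim[OF assms(1)] by simp

text \<open>A basis of \<open>U\<close> is an independent subset of \<open>U'\<close> with as many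
  elements as the dimension of \<open>U'\<close>, hence it spans \<open>U'\<close> as well.\<close>

lemma subspace_dim_vec_eqD:
  assumes U: "vec_subspace n (U :: 'a::field vec set)" and U': "vec_subspace n U'" and "U \<subseteq> U'"
    and d: "subspace_dim_vec n U = subspace_dim_vec n U'"
  shows "U = U'"
proof -
  interpret vec_space "TYPE('a)" n .
  have sub: "submodule class_ring U V" "submodule class_ring U' V"
    using U U' unfolding subspace_def by simp_all
  interpret W: vectorspace class_ring "vs U" by (rule vec_subspace_vs[OF U])
  interpret W': vectorspace class_ring "vs U'" by (rule vec_subspace_vs[OF U'])
  obtain B where B: "finite B" "W.basis B" "lin_indpt B" "B \<subseteq> U"
    using vec_subspace_basis[OF U] by blast
  have BU': "B \<subseteq> U'" using B \<open>U \<subseteq> U'\<close> by auto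
  have "W'.dim = card B" using d W.dim_basis[OF B(1,2)] unfolding subspace_dim_vec_def by simp
  moreover have "W'.lin_indpt B" using span_li_not_depend(2)[OF BU' sub(2)] B(3) by simp
  ultimately have "W'.basis B"
    using W'.dim_li_is_basis[OF vec_subspace_fin_dim[OF U'] B(1)] BU' by simp
  then have "W'.span B = U'" unfolding W'.basis_def by simp
  moreover have "W.span B = U" using B(2) unfolding W.basis_def by simp
  ultimately show ?thesis
    using span_li_not_depend(1)[OF BU' sub(2)] span_li_not_depend(1)[OF B(4) sub(1)] by simp
qed

lemma vec_subspace_carrier: "vec_subspace n (carrier_vec n :: 'a::field vec set)"
  by (rule vec_subspaceI) auto

lemma subspace_dim_vec_carrier: "subspace_dim_vec n (carrier_vec n :: 'a::field vec set) = n"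
proof -
  interpret vec_space "TYPE('a)" n .
  have "V\<lparr>carrier := carrier_vec n\<rparr> = V" by (simp add: module_vec_def)
  then show ?thesis unfolding subspace_dim_vec_def using dim_is_n by metis
qed

lemma subspace_dim_vec_zero: "subspace_dim_vec n {0\<^sub>v n :: 'a::field vec} = 0"
proof -
  interpret vec_space "TYPE('a)" n .
  have "span {} = {0\<^sub>v n}" using span_empty by simp
  then show ?thesis unfolding subspace_dim_vec_def using dim_zero_vs by simp
qed

lemma vec_subspace_kernel:
  assumes "vec_subspace a (U :: 'a::field vec set)" and A: "A \<in> carrier_mat b a"
  shows "vec_subspace a {u \<in> U. A *\<^sub>v u = 0\<^sub>v b}"
proof -
  note U = vec_subspaceD[OF assms(1)]
  have c: "u \<in> carrier_vec a" if "u \<in> U" for u using that U(1) by auto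
  show ?thesis
  proof (rule vec_subspaceI)
    show "0\<^sub>v a \<in> {u \<in> U. A *\<^sub>v u = 0\<^sub>v b}" using U(2) A by auto
  qed (use U A c in \<open>auto simp: mult_add_distrib_mat_vec[OF A] mult_mat_vec[OF A]\<close>)
qed

lemma vec_subspace_image:
  assumes "vec_subspace a (U :: 'a::field vec set)" and A: "A \<in> carrier_mat b a"
  shows "vec_subspace b ((*\<^sub>v) A ` U)"
proof -
  note U = vec_subspaceD[OF assms(1)]
  have c: "u \<in> carrier_vec a" if "u \<in> U" for u using that U(1) by auto
  show ?thesis
  proof (rule vec_subspaceI)
    show "(*\<^sub>v) A ` U \<subseteq> carrier_vec b" using A c by auto
    have "0\<^sub>v b = A *\<^sub>v 0\<^sub>v a" using A by auto
    then show "0\<^sub>v b \<in> (*\<^sub>v) A ` U" using U(2) by blast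
  next
    fix x y assume "x \<in> (*\<^sub>v) A ` U" "y \<in> (*\<^sub>v) A ` U"
    then obtain u v where "u \<in> U" "v \<in> U" "x = A *\<^sub>v u" "y = A *\<^sub>v v" by auto
    then have "x + y = A *\<^sub>v (u + v)" "u + v \<in> U"
      using c U(3) by (auto simp: mult_add_distrib_mat_vec[OF A])
    then show "x + y \<in> (*\<^sub>v) A ` U" by blast
  next
    fix k x assume "x \<in> (*\<^sub>v) A ` U"
    then obtain u where "u \<in> U" "x = A *\<^sub>v u" by auto
    then have "k \<cdot>\<^sub>v x = A *\<^sub>v (k \<cdot>\<^sub>v u)" "k \<cdot>\<^sub>v u \<in> U" 
      using c U(4) by (auto simp: mult_mat_vec[OF A])
    then show "k \<cdot>\<^sub>v x \<in> (*\<^sub>v) A ` U" by blast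
  qed
qed

text \<open>The map is restricted to \<open>U\<close> because the result is applied below to maps
  between kernels of consecutive Sylvester matrices.\<close>

lemma subspace_rank_nullity:
  assumes Us: "vec_subspace a (U :: 'a::field vec set)" and A: "A \<in> carrier_mat b a"
  shows "subspace_dim_vec b ((*\<^sub>v) A ` U) + subspace_dim_vec a {u \<in> U. A *\<^sub>v u = 0\<^sub>v b}
    = subspace_dim_vec a U"
proof -
  note U = vec_subspaceD[OF Us]
  have c: "u \<in> carrier_vec a" if "u \<in> U" for u using that U(1) by auto
  let ?V = "module_vec TYPE('a) a\<lparr>carrier := U\<rparr>"
  let ?W = "module_vec TYPE('a) b"
  interpret W: vectorspace class_ring ?W by (rule vec_vs)
  interpret V: vectorspace class_ring ?V by (rule vec_subspace_vs[OF Us])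
  have "(*\<^sub>v) A \<in> LinearCombinations.module_hom class_ring ?V ?W"
    using A c mult_add_distrib_mat_vec[OF A] mult_mat_vec[OF A]
    by (simp add: LinearCombinations.module_hom_def module_vec_simps)
  then interpret linear_map class_ring ?V ?W "(*\<^sub>v) A"
    by unfold_locales
  have im: "imT = (*\<^sub>v) A ` U" by (simp add: im_def)
  have ker: "kerT = {u \<in> U. A *\<^sub>v u = 0\<^sub>v b}" by (simp add: ker_def module_vec_simps)
  show ?thesis
    using rank_nullity[OF vec_subspace_fin_dim[OF Us]] unfolding im ker subspace_dim_vec_def by simp
qed

section \<open>Rank and kernel of a matrix, and full row rank\<close>

lemma mat_rank_eq_dim_image:
  assumes "A \<in> carrier_mat nr nc"
  shows "mat_rank A = subspace_dim_vec nr ((*\<^sub>v) A ` carrier_vec nc)"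
proof -
  interpret vec_space "TYPE('a)" nr .
  have "span (set (cols A)) = (*\<^sub>v) A ` carrier_vec nc"
    using col_space_eq[OF assms] assms unfolding col_space_def by auto
  then show ?thesis using assms by (simp add: mat_rank_def rank_def subspace_dim_vec_def)
qed

lemma kernel_dim_eq_dim:
  assumes "A \<in> carrier_mat nr nc"
  shows "kernel_dim A = subspace_dim_vec nc (mat_kernel A)"
  using assms by (simp add: kernel_dim_def subspace_dim_vec_def)

lemma mat_rank_add_kernel_dim:
  assumes A: "A \<in> carrier_mat nr nc"
  shows "mat_rank A + kernel_dim A = nc"
  using subspace_rank_nullity[OF vec_subspace_carrier A] mat_rank_eq_dim_image[OF A]
    kernel_dim_eq_dim[OF A] mat_kernel[OF A] subspace_dim_vec_carrier[of nc, where ?'a='a]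
  by simp

lemma mat_rank_eq_dim_row_iff:
  assumes A: "A \<in> carrier_mat nr nc"
  shows "mat_rank A = nr \<longleftrightarrow> (\<forall>w\<in>carrier_vec nr. \<exists>v\<in>carrier_vec nc. A *\<^sub>v v = w)"
proof -
  let ?I = "(*\<^sub>v) A ` carrier_vec nc"
  have sub: "?I \<subseteq> carrier_vec nr" using A by auto
  have r: "mat_rank A = nr \<longleftrightarrow> ?I = carrier_vec nr"
    using subspace_dim_vec_eqD[OF vec_subspace_image[OF vec_subspace_carrier A] vec_subspace_carrier sub]
    by (auto simp: mat_rank_eq_dim_image[OF A] subspace_dim_vec_carrier)
  have *: "?I = carrier_vec nr \<longleftrightarrow> (\<forall>w\<in>carrier_vec nr. \<exists>v\<in>carrier_vec nc. A *\<^sub>v v = w)"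
  proof
    assume I: "?I = carrier_vec nr"
    show "\<forall>w\<in>carrier_vec nr. \<exists>v\<in>carrier_vec nc. A *\<^sub>v v = w"
    proof
      fix w :: "'a vec" assume "w \<in> carrier_vec nr"
      then have "w \<in> ?I" unfolding I .
      then show "\<exists>v\<in>carrier_vec nc. A *\<^sub>v v = w" by fast
    qed
  next
    assume "\<forall>w\<in>carrier_vec nr. \<exists>v\<in>carrier_vec nc. A *\<^sub>v v = w"
    then have "carrier_vec nr \<subseteq> ?I" by fast
    with sub show "?I = carrier_vec nr" by (rule equalityI)
  qed
  show ?thesis using r * by simp
qed

text \<open>A zero row of the echelon form \<open>P * A\<close> would come from a row of
  \<open>P\<close> that annihilates \<open>A\<close>. By \<open>inj\<close> that row of
  \<open>P\<close> is zero, which contradicts invertibility of \<open>P\<close>. So all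
  \<open>nr\<close> rows have pivots and the kernel has dimension \<open>nc - nr\<close>.\<close>

lemma mat_rank_full_row_rankI:
  fixes A :: "'a::field mat"
  assumes A: "A \<in> carrier_mat nr nc" and le: "nr \<le> nc"
    and inj: "\<And>c. c \<in> carrier_vec nr \<Longrightarrow> (\<And>j. j < nc \<Longrightarrow> (\<Sum>i<nr. c $ i * A $$ (i, j)) = 0) \<Longrightarrow> c = 0\<^sub>v nr"
  shows "mat_rank A = nr"
proof -
  let ?B = "gauss_jordan_single A"
  from gauss_jordan_single[OF A refl]
  obtain P Q where AB: "?B = P * A" and QP: "P * Q = 1\<^sub>m nr" and QP': "Q * P = 1\<^sub>m nr" and
    P: "P \<in> carrier_mat nr nr" and Q: "Q \<in> carrier_mat nr nr" and B: "?B \<in> carrier_mat nr nc" and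
    row: "row_echelon_form ?B" by auto
  have nz: "row ?B i \<noteq> 0\<^sub>v nc" if i: "i < nr" for i
  proof
    assume z: "row ?B i = 0\<^sub>v nc"
    have "row P i = 0\<^sub>v nr"
    proof (rule inj)
      show "row P i \<in> carrier_vec nr" using P i by auto
      fix j assume j: "j < nc"
      have "(\<Sum>l<nr. row P i $ l * A $$ (l, j)) = (P * A) $$ (i, j)"
        using P A i j by (auto simp: scalar_prod_def intro!: sum.cong)
      also have "\<dots> = row ?B i $ j" using AB B i j by (metis carrier_matD index_row(1))
      finally show "(\<Sum>l<nr. row P i $ l * A $$ (l, j)) = 0" using z j by simp
    qed
    then have "(P * Q) $$ (i, i) = 0" using P Q i by (simp add: scalar_prod_left_zero)
    then show False using QP i by simp
  qed
  then have "{i. i < nr \<and> row ?B i \<noteq> 0\<^sub>v nc} = {..<nr}" by auto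
  then have "length (pivot_positions ?B) = nr" using find_base_vectors(5)[OF row B] by simp
  then have "kernel_dim A = nc - nr" using kernel_dim_code[of A] A by simp
  then show ?thesis using mat_rank_add_kernel_dim[OF A] le by simp
qed

text \<open>Deleting the zero rows outside \<open>I\<close> keeps the kernel and thus the rank. The
  remaining matrix has full row rank iff it is onto, that is, iff the entries of
  \<open>A *\<^sub>v v\<close> at \<open>I\<close> can be prescribed.\<close>

lemma mat_rank_eq_card_support_iff:
  fixes A :: "'a::field mat"
  assumes A: "A \<in> carrier_mat nr nc" and I: "I \<subseteq> {..<nr}"
    and z: "\<And>i j. i < nr \<Longrightarrow> i \<notin> I \<Longrightarrow> j < nc \<Longrightarrow> A $$ (i, j) = 0"
  shows "mat_rank A = card I \<longleftrightarrow>
    (\<forall>w. \<exists>v\<in>carrier_vec nc. \<forall>i\<in>I. (A *\<^sub>v v) $ i = w i)"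
proof -
  have fin: "finite I" using I finite_subset by blast
  obtain L where L: "set L = I" "distinct L" using finite_distinct_list[OF fin] by blast
  have len: "length L = card I" using L distinct_card by fastforce
  define A' where "A' = mat (card I) nc (\<lambda>(t, j). A $$ (L ! t, j))"
  have A': "A' \<in> carrier_mat (card I) nc" by (simp add: A'_def)
  have Lt: "L ! t < nr" "L ! t \<in> I" if "t < card I" for t
    using that len L(1) I nth_mem[of t L] by auto
  have ent: "(A' *\<^sub>v v) $ t = (A *\<^sub>v v) $ (L ! t)" if "t < card I" "v \<in> carrier_vec nc" for t v
    using that Lt[of t] A A' by (auto simp: A'_def scalar_prod_def intro!: sum.cong)
  have zero: "(A *\<^sub>v v) $ i = 0" if "i < nr" "i \<notin> I" "v \<in> carrier_vec nc" for i v
    using that A z by (auto simp: scalar_prod_def)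
  have "mat_kernel A = mat_kernel A'"
    unfolding mat_kernel[OF A] mat_kernel[OF A']
  proof (intro Collect_cong conj_cong refl)
    fix v :: "'a vec" assume v: "v \<in> carrier_vec nc"
    show "A *\<^sub>v v = 0\<^sub>v nr \<longleftrightarrow> A' *\<^sub>v v = 0\<^sub>v (card I)"
    proof
      assume "A *\<^sub>v v = 0\<^sub>v nr"
      then show "A' *\<^sub>v v = 0\<^sub>v (card I)" using ent v A' Lt by (intro eq_vecI) auto
    next
      assume 0: "A' *\<^sub>v v = 0\<^sub>v (card I)"
      show "A *\<^sub>v v = 0\<^sub>v nr"
      proof (rule eq_vecI)
        fix i assume "i < dim_vec (0\<^sub>v nr :: 'a vec)"
        then have i: "i < nr" by simp
        have "(A *\<^sub>v v) $ i = 0"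
        proof (cases "i \<in> I")
          case True
          then obtain t where "t < card I" "i = L ! t" using L len by (metis in_set_conv_nth)
          then show ?thesis using ent[of t v] v 0 by simp
        qed (use zero i v in auto)
        then show "(A *\<^sub>v v) $ i = 0\<^sub>v nr $ i" using i by simp
      qed (use A in auto)
    qed
  qed
  then have "mat_rank A = mat_rank A'"
    using mat_rank_add_kernel_dim[OF A] mat_rank_add_kernel_dim[OF A']
      kernel_dim_eq_dim[OF A] kernel_dim_eq_dim[OF A'] by simp
  then have "mat_rank A = card I \<longleftrightarrow>
      (\<forall>w\<in>carrier_vec (card I). \<exists>v\<in>carrier_vec nc. A' *\<^sub>v v = w)"
    using mat_rank_eq_dim_row_iff[OF A'] by simp
  also have "\<dots> \<longleftrightarrow> (\<forall>w. \<exists>v\<in>carrier_vec nc. \<forall>i\<in>I. (A *\<^sub>v v) $ i = w i)"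
  proof (intro iffI allI ballI)
    fix w assume *: "\<forall>w\<in>carrier_vec (card I). \<exists>v\<in>carrier_vec nc. A' *\<^sub>v v = w"
    then obtain v where v: "v \<in> carrier_vec nc" "A' *\<^sub>v v = vec (card I) (\<lambda>t. w (L ! t))"
      using vec_carrier by blast
    have "(A *\<^sub>v v) $ i = w i" if i: "i \<in> I" for i
    proof -
      obtain t where "t < card I" "i = L ! t" using L len i by (metis in_set_conv_nth)
      then show ?thesis using ent[of t v] v by simp
    qed
    then show "\<exists>v\<in>carrier_vec nc. \<forall>i\<in>I. (A *\<^sub>v v) $ i = w i" using v by blast
  next
    fix w :: "'a vec" assume w: "w \<in> carrier_vec (card I)"
      and *: "\<forall>w. \<exists>v\<in>carrier_vec nc. \<forall>i\<in>I. (A *\<^sub>v v) $ i = w i"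
    \<comment> \<open>Transports the target from positions in \<open>L\<close> to row indices; the
      position is unique because \<open>L\<close> is distinct.\<close>
    define w' where "w' i = w $ (THE t. t < card I \<and> L ! t = i)" for i
    have w': "w' (L ! t) = w $ t" if "t < card I" for t
    proof -
      have "(THE s. s < card I \<and> L ! s = L ! t) = t"
        by (rule the_equality) (use that len nth_eq_iff_index_eq[OF L(2)] in auto)
      then show ?thesis by (simp add: w'_def)
    qed
    from * obtain v where v: "v \<in> carrier_vec nc" "\<forall>i\<in>I. (A *\<^sub>v v) $ i = w' i" by blast
    have "A' *\<^sub>v v = w"
      using w A' v ent w' Lt by (intro eq_vecI) auto
    then show "\<exists>v\<in>carrier_vec nc. A' *\<^sub>v v = w" using v by blast
  qed
  finally show ?thesis .
qed

lemma vec_subspace_mat_kernel: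
  assumes "A \<in> carrier_mat nr nc"
  shows "vec_subspace nc (mat_kernel A)"
  using vec_subspace_kernel[OF vec_subspace_carrier assms] mat_kernel[OF assms] by simp

section \<open>Sylvester matrices as multiplication operators\<close>

lemma sum_blocks: "sum f {..<k * q :: nat} = (\<Sum>j<k. \<Sum>c<q. f (j * q + c))"
proof -
  have "sum f {j * q..<j * q + q} = (\<Sum>c<q. f (j * q + c))" for j
    by (rule sum.reindex_bij_witness[of _ "\<lambda>c. j * q + c" "\<lambda>b. b - j * q"]) auto
  then show ?thesis using sum.nat_group[of f q k] by simp
qed

lemma block_index:
  fixes q :: nat
  assumes "c < q" "j < k"
  shows "j * q + c < k * q" "(j * q + c) div q = j" "(j * q + c) mod q = c"
proof -
  have "j * q + c < Suc j * q" using assms by simp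
  also have "\<dots> \<le> k * q" using assms by (intro mult_right_mono) auto
  finally show "j * q + c < k * q" .
qed (use assms in auto)

lemma block_index_cases:
  fixes q :: nat
  assumes "b < k * q"
  obtains j c where "j < k" "c < q" "b = j * q + c"
proof
  show "b div q < k" using assms by (simp add: less_mult_imp_div_less)
  show "b mod q < q" using assms by (cases "q = 0") auto
  show "b = b div q * q + b mod q" by simp
qed

text \<open>Taking block \<open>j\<close> of \<open>v\<close> as the coefficient of
  \<open>\<lambda>^j\<close> identifies vectors of length \<open>k * q\<close> with polynomial
  vectors of length \<open>q\<close> and degree below \<open>k\<close>; this is entry
  \<open>c\<close> of the latter.\<close>

definition block_poly :: "nat \<Rightarrow> nat \<Rightarrow> 'a::field vec \<Rightarrow> nat \<Rightarrow> 'a poly" where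
  "block_poly k q v c = (\<Sum>j<k. monom (v $ (j * q + c)) j)"

lemma coeff_block_poly:
  "coeff (block_poly k q v c) j = (if j < k then v $ (j * q + c) else 0)"
  unfolding block_poly_def by (simp add: coeff_sum coeff_monom)

lemma block_poly_surj:
  assumes "\<And>c j. c < q \<Longrightarrow> k \<le> j \<Longrightarrow> coeff (p c) j = 0"
  obtains v where "v \<in> carrier_vec (k * q)" "\<And>c. c < q \<Longrightarrow> block_poly k q v c = p c"
proof
  let ?v = "vec (k * q) (\<lambda>b. coeff (p (b mod q)) (b div q))"
  show "?v \<in> carrier_vec (k * q)" by simp
  fix c assume "c < q"
  then show "block_poly k q ?v c = p c"
    using assms by (intro poly_eqI) (auto simp: coeff_block_poly block_index)
qed

locale poly_mat =
  fixes M :: "'a::field poly mat" and m q d :: nat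
  assumes M: "M \<in> carrier_mat m q"
    and degree_le: "i < m \<Longrightarrow> j < q \<Longrightarrow> degree (M $$ (i, j)) \<le> d"
begin

definition mult_col :: "(nat \<Rightarrow> 'a poly) \<Rightarrow> nat \<Rightarrow> 'a poly" where
  "mult_col p s = (\<Sum>c<q. M $$ (s, c) * p c)"

definition mult_row :: "(nat \<Rightarrow> 'a poly) \<Rightarrow> nat \<Rightarrow> 'a poly" where
  "mult_row b c = (\<Sum>s<m. b s * M $$ (s, c))"

abbreviation "rdeg \<equiv> row_degree M"
abbreviation "syl \<equiv> sylvester_mat d M"

lemma degree_le_rdeg: "s < m \<Longrightarrow> c < q \<Longrightarrow> degree (M $$ (s, c)) \<le> rdeg s"
  unfolding row_degree_def vec_degree_def using M
  by (intro Max_ge) (auto intro!: disjI2 exI[of _ c])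

lemma coeff_above_rdeg: "s < m \<Longrightarrow> c < q \<Longrightarrow> rdeg s < i \<Longrightarrow> coeff (M $$ (s, c)) i = 0"
  using degree_le_rdeg by (intro coeff_eq_0) fastforce

lemma rdeg_le: "s < m \<Longrightarrow> rdeg s \<le> d"
  unfolding row_degree_def vec_degree_def using M degree_le by (intro Max.boundedI) auto

lemma mult_col_cong: "(\<And>c. c < q \<Longrightarrow> p c = p' c) \<Longrightarrow> mult_col p s = mult_col p' s"
  unfolding mult_col_def by (intro sum.cong) auto

lemma coeff_mult_col_block:
  "coeff (mult_col (block_poly k q v) s) i
    = (\<Sum>j<k. \<Sum>c<q. (if j \<le> i then coeff (M $$ (s, c)) (i - j) else 0) * v $ (j * q + c))"
proof -
  have "coeff (M $$ (s, c) * block_poly k q v c) i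
      = (\<Sum>j<k. (if j \<le> i then coeff (M $$ (s, c)) (i - j) else 0) * v $ (j * q + c))" for c
  proof -
    have "M $$ (s, c) * block_poly k q v c = (\<Sum>j<k. monom (v $ (j * q + c)) j * M $$ (s, c))"
      unfolding block_poly_def sum_distrib_left by (intro sum.cong refl mult.commute)
    then show ?thesis by (auto simp: coeff_sum coeff_monom_mult intro!: sum.cong)
  qed
  then show ?thesis
    unfolding mult_col_def by (simp add: coeff_sum sum.swap[of _ "{..<k}"])
qed

lemma coeff_mult_col_block_0:
  assumes "s < m" "k + rdeg s \<le> i"
  shows "coeff (mult_col (block_poly k q v) s) i = 0"
  unfolding coeff_mult_col_block using assms
  by (intro sum.neutral ballI) (auto simp: coeff_above_rdeg)

lemma sylvester_carrier: "syl k \<in> carrier_mat ((k + d) * m) (k * q)"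
  using M by (simp add: sylvester_mat_def)

lemma sylvester_entry:
  assumes "i < k + d" "s < m" "j < k" "c < q"
  shows "syl k $$ (i * m + s, j * q + c) = (if j \<le> i then coeff (M $$ (s, c)) (i - j) else 0)"
  using assms M block_index[of s m i "k + d"] block_index[of c q j k] degree_le[of s c]
  by (auto simp: sylvester_mat_def coeff_mat_def Let_def coeff_eq_0)

text \<open>The block Toeplitz shape of \<open>syl k\<close> is the convolution of coefficients, so
  block row \<open>i\<close> of the product collects the coefficients of \<open>\<lambda>^i\<close>
  in \<open>M p\<close>.\<close>

lemma sylvester_mult_vec:
  assumes "i < k + d" "s < m" "v \<in> carrier_vec (k * q)"
  shows "(syl k *\<^sub>v v) $ (i * m + s) = coeff (mult_col (block_poly k q v) s) i"
proof -
  have "(syl k *\<^sub>v v) $ (i * m + s) = (\<Sum>b<k * q. syl k $$ (i * m + s, b) * v $ b)"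
    using sylvester_carrier[of k] assms block_index[of s m i "k + d"]
    by (auto simp: scalar_prod_def lessThan_atLeast0 intro!: sum.cong)
  also have "\<dots> = coeff (mult_col (block_poly k q v) s) i"
    unfolding coeff_mult_col_block sum_blocks using assms
    by (intro sum.cong refl) (simp add: sylvester_entry)
  finally show ?thesis .
qed

text \<open>The block rows cover the coefficients of \<open>\<lambda>^i\<close> for
  \<open>i < k + d\<close>. Those beyond vanish in every product \<open>M p\<close> with
  \<open>deg p < k\<close>, since \<open>rdeg s \<le> d\<close>.\<close>

lemma mat_kernel_sylvester:
  "mat_kernel (syl k) = {v \<in> carrier_vec (k * q). \<forall>s<m. mult_col (block_poly k q v) s = 0}"
proof -
  have "syl k *\<^sub>v v = 0\<^sub>v ((k + d) * m) \<longleftrightarrow> (\<forall>s<m. mult_col (block_poly k q v) s = 0)"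
    if v: "v \<in> carrier_vec (k * q)" for v
  proof
    assume 0: "syl k *\<^sub>v v = 0\<^sub>v ((k + d) * m)"
    show "\<forall>s<m. mult_col (block_poly k q v) s = 0"
    proof (intro allI impI poly_eqI)
      fix s i assume s: "s < m"
      show "coeff (mult_col (block_poly k q v) s) i = coeff 0 i"
      proof (cases "i < k + d")
        case True
        then show ?thesis
          using sylvester_mult_vec[OF True s v] 0 block_index[of s m i "k + d"] s by simp
      next
        case False
        then show ?thesis using coeff_mult_col_block_0[OF s] rdeg_le[OF s] by simp
      qed
    qed
  next
    assume 0: "\<forall>s<m. mult_col (block_poly k q v) s = 0"
    show "syl k *\<^sub>v v = 0\<^sub>v ((k + d) * m)"
    proof (rule eq_vecI)
      fix a assume "a < dim_vec (0\<^sub>v ((k + d) * m) :: 'a vec)"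
      then have a: "a < (k + d) * m" by simp
      then obtain i s where "i < k + d" "s < m" "a = i * m + s" by (rule block_index_cases)
      then show "(syl k *\<^sub>v v) $ a = 0\<^sub>v ((k + d) * m) $ a"
        using a sylvester_mult_vec[OF _ _ v] 0 by simp
    qed (use sylvester_carrier in auto)
  qed
  then show ?thesis unfolding mat_kernel[OF sylvester_carrier] by auto
qed

text \<open>For \<open>k = 0\<close> the matrix has no columns, so the value 0 fixed in the
  definition is its actual rank.\<close>

lemma sylvester_rank_eq: "sylvester_rank d M k = mat_rank (syl k)"
proof (cases "k = 0")
  case True
  then have "mat_rank (syl k) = 0"
    using mat_rank_add_kernel_dim[OF sylvester_carrier[of k]] by simp
  then show ?thesis using True by (simp add: sylvester_rank_def)
qed (simp add: sylvester_rank_def)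

lemma sylvester_nullity_eq: "sylvester_nullity d M k = kernel_dim (syl k)"
proof (cases "k = 0")
  case True
  then have "kernel_dim (syl k) = 0"
    using mat_rank_add_kernel_dim[OF sylvester_carrier[of k]] by simp
  then show ?thesis using True by (simp add: sylvester_nullity_def)
qed (simp add: sylvester_nullity_def)

lemma sylvester_rank_add_nullity: "sylvester_rank d M k + sylvester_nullity d M k = k * q"
  using mat_rank_add_kernel_dim[OF sylvester_carrier]
  by (simp add: sylvester_rank_eq sylvester_nullity_eq)

section \<open>The largest possible rank: rows that can be nonzero, and surjectivity onto
  them\<close>

definition sylvester_support :: "nat \<Rightarrow> nat set" where
  "sylvester_support k = {a. a < (k + d) * m \<and> a div m < k + rdeg (a mod m)}"

text \<open>Row \<open>i * m + s\<close> holds the coefficient of \<open>\<lambda>^i\<close> in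
  entry \<open>s\<close>. For each \<open>s\<close> there remain \<open>k + rdeg s\<close> values of
  \<open>i\<close>, all in range because \<open>rdeg s \<le> d\<close>.\<close>

lemma card_sylvester_support: "card (sylvester_support k) = k * m + (\<Sum>s<m. rdeg s)"
proof -
  have "bij_betw (\<lambda>(s, i). i * m + s) (SIGMA s:{..<m}. {..<k + rdeg s}) (sylvester_support k)"
  proof (rule bij_betw_byWitness[where f' = "\<lambda>a. (a mod m, a div m)"])
    show "(\<lambda>(s, i). i * m + s) ` (SIGMA s:{..<m}. {..<k + rdeg s}) \<subseteq> sylvester_support k"
    proof (clarsimp simp: sylvester_support_def)
      fix s i assume "s < m" "i < k + rdeg s"
      then show "i * m + s < (k + d) * m"
        using block_index(1)[of s m i "k + d"] rdeg_le[of s] by simp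
    qed
    show "(\<lambda>a. (a mod m, a div m)) ` sylvester_support k \<subseteq> (SIGMA s:{..<m}. {..<k + rdeg s})"
      by (auto simp: sylvester_support_def) (metis mod_less_divisor mult_0_right not_gr0 not_less0)
  qed auto
  then have "card (sylvester_support k) = card (SIGMA s:{..<m}. {..<k + rdeg s})"
    by (simp add: bij_betw_same_card)
  then show ?thesis by (simp add: sum.distrib)
qed

text \<open>The image of \<open>syl k\<close> is all of the space \<open>D\<^sub>k\<close>. Degree
  bounds are written as vanishing coefficients because \<open>degree\<close> cannot express a bound
  below 0, which occurs for \<open>k = 0\<close>.\<close>

definition full_image :: "nat \<Rightarrow> bool" where
  "full_image k \<longleftrightarrow> (\<forall>f. (\<forall>s<m. \<forall>i\<ge>k + rdeg s. coeff (f s) i = 0) \<longrightarrow>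
      (\<exists>p. (\<forall>c<q. \<forall>j\<ge>k. coeff (p c) j = 0) \<and> (\<forall>s<m. mult_col p s = f s)))"

text \<open>The stated rank is the largest possible one, since entry \<open>s\<close> of a product \<open>M p\<close>
  with \<open>deg p < k\<close> has degree below \<open>k + rdeg s\<close>.\<close>

lemma sylvester_rank_eq_iff:
  "sylvester_rank d M k = k * m + (\<Sum>s<m. rdeg s) \<longleftrightarrow> full_image k"
  (is "?l \<longleftrightarrow> ?r")
proof -
  have "?l \<longleftrightarrow> (\<forall>w. \<exists>v\<in>carrier_vec (k * q). \<forall>a\<in>sylvester_support k. (syl k *\<^sub>v v) $ a = w a)"
    (is "_ \<longleftrightarrow> ?s")
    unfolding sylvester_rank_eq card_sylvester_support[symmetric]
  proof (rule mat_rank_eq_card_support_iff[OF sylvester_carrier])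
    show "sylvester_support k \<subseteq> {..<(k + d) * m}" by (auto simp: sylvester_support_def)
    fix a b assume a: "a < (k + d) * m" "a \<notin> sylvester_support k" and b: "b < k * q"
    obtain i s where ix: "i < k + d" "s < m" "a = i * m + s" using a(1) by (rule block_index_cases)
    obtain j c where jc: "j < k" "c < q" "b = j * q + c" using b by (rule block_index_cases)
    have "k + rdeg s \<le> i" using a ix by (auto simp: sylvester_support_def)
    then show "syl k $$ (a, b) = 0"
      using ix jc by (auto simp: sylvester_entry coeff_above_rdeg)
  qed
  also have "?s \<longleftrightarrow> ?r"
  proof
    assume s: ?s
    show ?r
      unfolding full_image_def
    proof (intro allI impI)
      fix f :: "nat \<Rightarrow> 'a poly" assume f: "\<forall>s<m. \<forall>i\<ge>k + rdeg s. coeff (f s) i = 0"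
      obtain v where v: "v \<in> carrier_vec (k * q)"
        "\<forall>a\<in>sylvester_support k. (syl k *\<^sub>v v) $ a = coeff (f (a mod m)) (a div m)"
        using spec[OF s, of "\<lambda>a. coeff (f (a mod m)) (a div m)"] by blast
      have "mult_col (block_poly k q v) s = f s" if s: "s < m" for s
      proof (rule poly_eqI)
        fix i show "coeff (mult_col (block_poly k q v) s) i = coeff (f s) i"
        proof (cases "i < k + rdeg s")
          case True
          then have i: "i < k + d" using rdeg_le[OF s] by simp
          then have "i * m + s \<in> sylvester_support k"
            using block_index[of s m i "k + d"] s True by (simp add: sylvester_support_def)
          then show ?thesis using v(2) sylvester_mult_vec[OF i s v(1)] s by fastforce
        next
          case False
          then show ?thesis using coeff_mult_col_block_0[OF s] f s by simp
        qed
      qed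
      then show "\<exists>p. (\<forall>c<q. \<forall>j\<ge>k. coeff (p c) j = 0) \<and> (\<forall>s<m. mult_col p s = f s)"
        by (intro exI[of _ "block_poly k q v"]) (auto simp: coeff_block_poly)
    qed
  next
    assume r: ?r
    show ?s
    proof
      fix w :: "nat \<Rightarrow> 'a"
      define f where "f s = (\<Sum>i<k + rdeg s. monom (w (i * m + s)) i)" for s
      have f: "coeff (f s) i = (if i < k + rdeg s then w (i * m + s) else 0)" for s i
        by (simp add: f_def coeff_sum coeff_monom)
      from r f obtain p where p: "\<And>c j. c < q \<Longrightarrow> k \<le> j \<Longrightarrow> coeff (p c) j = 0"
        "\<forall>s<m. mult_col p s = f s" unfolding full_image_def by (metis not_le)
      obtain v where v: "v \<in> carrier_vec (k * q)" "\<And>c. c < q \<Longrightarrow> block_poly k q v c = p c"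
        using block_poly_surj[of q k p] p(1) by blast
      have "(syl k *\<^sub>v v) $ a = w a" if a: "a \<in> sylvester_support k" for a
      proof -
        have "a < (k + d) * m" using a by (simp add: sylvester_support_def)
        then obtain i s where ix: "i < k + d" "s < m" "a = i * m + s" by (rule block_index_cases)
        then have "(syl k *\<^sub>v v) $ a = coeff (f s) i"
          using sylvester_mult_vec[OF ix(1,2) v(1)] mult_col_cong[OF v(2)] p(2) by simp
        then show ?thesis using a ix f by (auto simp: sylvester_support_def)
      qed
      then show "\<exists>v\<in>carrier_vec (k * q). \<forall>a\<in>sylvester_support k. (syl k *\<^sub>v v) $ a = w a"
        using v(1) by blast
    qed
  qed
  finally show ?thesis .
qed

subsection \<open>Increments of the nullities\<close>

definition lead_space :: "nat \<Rightarrow> 'a vec set" where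
  "lead_space k = {u \<in> carrier_vec q. \<exists>p. (\<forall>c<q. \<forall>j>k. coeff (p c) j = 0) \<and>
     (\<forall>s<m. mult_col p s = 0) \<and> (\<forall>c<q. u $ c = coeff (p c) k)}"

text \<open>Reading the last block (\<open>top_mat\<close>) and appending a zero block
  (\<open>pad_mat\<close>) form a short exact sequence: the kernel of \<open>syl k\<close> embeds
  into that of \<open>syl (Suc k)\<close>, with quotient \<open>lead_space k\<close>.\<close>

definition top_mat :: "nat \<Rightarrow> 'a mat" where
  "top_mat k = mat q (Suc k * q) (\<lambda>(c, b). if b = k * q + c then 1 else 0)"

definition pad_mat :: "nat \<Rightarrow> 'a mat" where
  "pad_mat k = mat (Suc k * q) (k * q) (\<lambda>(a, b). if a = b then 1 else 0)"

lemma top_mat_carrier: "top_mat k \<in> carrier_mat q (Suc k * q)"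
  by (simp add: top_mat_def)

lemma pad_mat_carrier: "pad_mat k \<in> carrier_mat (Suc k * q) (k * q)"
  by (simp add: pad_mat_def)

lemma top_mat_mult:
  assumes "v \<in> carrier_vec (Suc k * q)" "c < q"
  shows "(top_mat k *\<^sub>v v) $ c = v $ (k * q + c)"
proof -
  have "(top_mat k *\<^sub>v v) $ c = (\<Sum>b<Suc k * q. (if b = k * q + c then 1 else 0) * v $ b)"
    using assms by (simp add: top_mat_def scalar_prod_def lessThan_atLeast0)
  also have "\<dots> = (\<Sum>b<Suc k * q. if b = k * q + c then v $ b else 0)"
    by (intro sum.cong) auto
  finally show ?thesis using assms by simp
qed

lemma pad_mat_mult:
  assumes "v \<in> carrier_vec (k * q)" "a < Suc k * q"
  shows "(pad_mat k *\<^sub>v v) $ a = (if a < k * q then v $ a else 0)"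
proof -
  have "(pad_mat k *\<^sub>v v) $ a = (\<Sum>b<k * q. (if a = b then 1 else 0) * v $ b)"
    using assms by (simp add: pad_mat_def scalar_prod_def lessThan_atLeast0)
  also have "\<dots> = (\<Sum>b<k * q. if a = b then v $ b else 0)"
    by (intro sum.cong) auto
  finally show ?thesis by simp
qed

lemma block_poly_pad:
  assumes "v \<in> carrier_vec (k * q)" "c < q"
  shows "block_poly (Suc k) q (pad_mat k *\<^sub>v v) c = block_poly k q v c"
proof (rule poly_eqI)
  fix j
  consider "j < k" | "j = k" | "j > k" by linarith
  then show "coeff (block_poly (Suc k) q (pad_mat k *\<^sub>v v) c) j = coeff (block_poly k q v c) j"
  proof cases
    case 1
    then have "j * q + c < k * q" "j * q + c < Suc k * q"
      using block_index(1)[OF assms(2), of j k] by simp_all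
    then show ?thesis using 1 pad_mat_mult[OF assms(1)] by (simp add: coeff_block_poly)
  next
    case 2
    then show ?thesis using pad_mat_mult[OF assms(1), of "k * q + c"] assms(2)
      by (simp add: coeff_block_poly)
  qed (simp add: coeff_block_poly)
qed

lemma top_mat_image: "(*\<^sub>v) (top_mat k) ` mat_kernel (syl (Suc k)) = lead_space k"
proof (intro equalityI subsetI)
  fix u assume "u \<in> (*\<^sub>v) (top_mat k) ` mat_kernel (syl (Suc k))"
  then obtain v where v: "v \<in> carrier_vec (Suc k * q)"
    "\<forall>s<m. mult_col (block_poly (Suc k) q v) s = 0" "u = top_mat k *\<^sub>v v"
    unfolding mat_kernel_sylvester by blast
  then show "u \<in> lead_space k"
    unfolding lead_space_def using top_mat_mult[OF v(1)] top_mat_carrier[of k]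
    by (auto intro!: exI[of _ "block_poly (Suc k) q v"] simp: coeff_block_poly)
next
  fix u assume "u \<in> lead_space k"
  then obtain p where u: "u \<in> carrier_vec q" and p: "\<forall>c<q. \<forall>j>k. coeff (p c) j = 0"
    "\<forall>s<m. mult_col p s = 0" "\<forall>c<q. u $ c = coeff (p c) k"
    unfolding lead_space_def by blast
  obtain v where v: "v \<in> carrier_vec (Suc k * q)" "\<And>c. c < q \<Longrightarrow> block_poly (Suc k) q v c = p c"
    using block_poly_surj[of q "Suc k" p] p(1) by (metis Suc_le_lessD)
  have "mult_col (block_poly (Suc k) q v) s = 0" if "s < m" for s
    using mult_col_cong[OF v(2), where s = s] p(2) that by simp
  then have "v \<in> mat_kernel (syl (Suc k))" unfolding mat_kernel_sylvester using v(1) by blast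
  moreover have "u = top_mat k *\<^sub>v v"
  proof (rule eq_vecI)
    fix c assume "c < dim_vec (top_mat k *\<^sub>v v)"
    then have c: "c < q" using top_mat_carrier[of k] by simp
    then have "u $ c = coeff (block_poly (Suc k) q v c) k" using p(3) v(2) by simp
    then show "u $ c = (top_mat k *\<^sub>v v) $ c"
      using top_mat_mult[OF v(1) c] by (simp add: coeff_block_poly)
  qed (use u top_mat_carrier[of k] in auto)
  ultimately show "u \<in> (*\<^sub>v) (top_mat k) ` mat_kernel (syl (Suc k))" by blast
qed

text \<open>Exactness in the middle: a kernel vector whose last block vanishes encodes a polynomial
  vector of degree below \<open>k\<close>, so its first \<open>k\<close> blocks already lie in the
  smaller kernel.\<close>

lemma pad_mat_image:
  "(*\<^sub>v) (pad_mat k) ` mat_kernel (syl k)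
    = {u \<in> mat_kernel (syl (Suc k)). top_mat k *\<^sub>v u = 0\<^sub>v q}"
proof (intro equalityI subsetI)
  fix u assume "u \<in> (*\<^sub>v) (pad_mat k) ` mat_kernel (syl k)"
  then obtain v where v: "v \<in> carrier_vec (k * q)" "\<forall>s<m. mult_col (block_poly k q v) s = 0"
    and u: "u = pad_mat k *\<^sub>v v"
    unfolding mat_kernel_sylvester by blast
  have uc: "u \<in> carrier_vec (Suc k * q)"
    unfolding u by (rule mult_mat_vec_carrier[OF pad_mat_carrier v(1)])
  have "mult_col (block_poly (Suc k) q u) s = 0" if "s < m" for s
    using mult_col_cong[OF block_poly_pad[OF v(1)], where s = s] v(2) that u by simp
  moreover have "top_mat k *\<^sub>v u = 0\<^sub>v q"
    using top_mat_mult[OF uc] pad_mat_mult[OF v(1)] top_mat_carrier[of k] u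
    by (intro eq_vecI) auto
  ultimately show "u \<in> {u \<in> mat_kernel (syl (Suc k)). top_mat k *\<^sub>v u = 0\<^sub>v q}"
    unfolding mat_kernel_sylvester using uc by blast
next
  fix u assume "u \<in> {u \<in> mat_kernel (syl (Suc k)). top_mat k *\<^sub>v u = 0\<^sub>v q}"
  then have u: "u \<in> carrier_vec (Suc k * q)" "\<forall>s<m. mult_col (block_poly (Suc k) q u) s = 0"
    and top: "top_mat k *\<^sub>v u = 0\<^sub>v q"
    unfolding mat_kernel_sylvester by auto
  define v where "v = vec (k * q) (($) u)"
  have v: "v \<in> carrier_vec (k * q)" by (simp add: v_def)
  have uv: "u = pad_mat k *\<^sub>v v"
  proof (rule eq_vecI)
    fix a assume "a < dim_vec (pad_mat k *\<^sub>v v)"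
    then have a: "a < Suc k * q" using pad_mat_carrier[of k] by auto
    show "u $ a = (pad_mat k *\<^sub>v v) $ a"
    proof (cases "a < k * q")
      case True
      then show ?thesis using pad_mat_mult[OF v a] by (simp add: v_def)
    next
      case False
      then have "a - k * q < q" "k * q + (a - k * q) = a" using a by auto
      then have "u $ a = 0" using top_mat_mult[OF u(1), of "a - k * q"] top by simp
      then show ?thesis using pad_mat_mult[OF v a] False by simp
    qed
  qed (use u pad_mat_carrier[of k] in auto)
  have "mult_col (block_poly k q v) s = 0" if "s < m" for s
  proof -
    have "mult_col (block_poly (Suc k) q u) s = mult_col (block_poly k q v) s"
      unfolding uv by (rule mult_col_cong) (rule block_poly_pad[OF v])
    then show ?thesis using u(2) that by simp
  qed
  then have "v \<in> mat_kernel (syl k)" unfolding mat_kernel_sylvester using v by blast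
  then show "u \<in> (*\<^sub>v) (pad_mat k) ` mat_kernel (syl k)" using uv by blast
qed

lemma vec_subspace_lead_space: "vec_subspace q (lead_space k)"
  unfolding top_mat_image[symmetric]
  by (rule vec_subspace_image[OF vec_subspace_mat_kernel[OF sylvester_carrier] top_mat_carrier])

text \<open>Rank-nullity is used for both maps of the exact sequence: padding is injective, and its
  image is the kernel of \<open>top_mat k\<close> on the larger kernel, which
  \<open>top_mat k\<close> maps onto \<open>lead_space k\<close>.\<close>

lemma sylvester_nullity_Suc:
  "sylvester_nullity d M (Suc k) = sylvester_nullity d M k + subspace_dim_vec q (lead_space k)"
proof -
  note ker = vec_subspace_mat_kernel[OF sylvester_carrier]
  have "{u \<in> mat_kernel (syl k). pad_mat k *\<^sub>v u = 0\<^sub>v (Suc k * q)} = {0\<^sub>v (k * q)}"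
  proof (intro equalityI subsetI)
    fix u assume u: "u \<in> {u \<in> mat_kernel (syl k). pad_mat k *\<^sub>v u = 0\<^sub>v (Suc k * q)}"
    then have uc: "u \<in> carrier_vec (k * q)" unfolding mat_kernel_sylvester by blast
    have "u $ a = 0" if "a < k * q" for a
      using pad_mat_mult[OF uc, of a] u that by simp
    then show "u \<in> {0\<^sub>v (k * q)}" using uc by (auto intro: eq_vecI)
  next
    fix u :: "'a vec" assume "u \<in> {0\<^sub>v (k * q)}"
    then show "u \<in> {u \<in> mat_kernel (syl k). pad_mat k *\<^sub>v u = 0\<^sub>v (Suc k * q)}"
      using vec_subspaceD(2)[OF ker] pad_mat_carrier[of k] by auto
  qed
  then have "subspace_dim_vec (Suc k * q) ((*\<^sub>v) (pad_mat k) ` mat_kernel (syl k))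
      = sylvester_nullity d M k"
    using subspace_rank_nullity[OF ker pad_mat_carrier, of k]
      kernel_dim_eq_dim[OF sylvester_carrier, of k]
      subspace_dim_vec_zero[of "k * q", where ?'a='a] by (simp add: sylvester_nullity_eq)
  then show ?thesis
    using subspace_rank_nullity[OF ker top_mat_carrier, of k] kernel_dim_eq_dim[OF sylvester_carrier, of "Suc k"]
    unfolding top_mat_image pad_mat_image[symmetric] by (simp add: sylvester_nullity_eq)
qed

text \<open>Multiplying a kernel vector by \<open>\<lambda>\<close>, that is applying
  \<open>pCons 0\<close>, moves the degree bound from \<open>k\<close> to \<open>Suc k\<close> and
  keeps the top coefficient.\<close>

lemma lead_space_mono: "lead_space k \<subseteq> lead_space (Suc k)"
proof
  fix u assume "u \<in> lead_space k"
  then obtain p where u: "u \<in> carrier_vec q" and p: "\<forall>c<q. \<forall>j>k. coeff (p c) j = 0"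
    "\<forall>s<m. mult_col p s = 0" "\<forall>c<q. u $ c = coeff (p c) k"
    unfolding lead_space_def by blast
  have "mult_col (\<lambda>c. pCons 0 (p c)) s = pCons 0 (mult_col p s)" for s
  proof -
    have "coeff (\<Sum>c<q. M $$ (s, c) * pCons 0 (p c)) i
        = coeff (pCons 0 (\<Sum>c<q. M $$ (s, c) * p c)) i" for i
      by (cases i) (simp_all add: coeff_sum)
    then show ?thesis unfolding mult_col_def by (intro poly_eqI)
  qed
  moreover have "\<forall>c<q. \<forall>j>Suc k. coeff (pCons 0 (p c)) j = 0"
    using p(1) by (auto simp: coeff_pCons split: nat.split)
  ultimately show "u \<in> lead_space (Suc k)"
    unfolding lead_space_def using u p(2,3)
    by (auto intro!: exI[of _ "\<lambda>c. pCons 0 (p c)"] simp: coeff_pCons)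
qed

text \<open>The increments are monotone, hence constant between two indices at which they agree.\<close>

lemma sylvester_nullity_linear:
  assumes "k \<le> K"
    and k: "sylvester_nullity d M (Suc k) = sylvester_nullity d M k + n"
    and K: "sylvester_nullity d M (Suc K) = sylvester_nullity d M K + n"
  shows "sylvester_nullity d M K = sylvester_nullity d M k + (K - k) * n"
proof -
  define \<delta> where "\<delta> j = subspace_dim_vec q (lead_space j)" for j
  have "mono \<delta>"
    unfolding \<delta>_def mono_iff_le_Suc
    using subspace_dim_vec_mono[OF vec_subspace_lead_space vec_subspace_lead_space lead_space_mono]
    by blast
  moreover have "\<delta> k = n" "\<delta> K = n" using k K sylvester_nullity_Suc unfolding \<delta>_def by simp_all
  ultimately have \<delta>: "\<delta> j = n" if "k \<le> j" "j \<le> K" for j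
    using monoD[of \<delta> k j] monoD[of \<delta> j K] that by simp
  have "j \<le> K \<Longrightarrow> sylvester_nullity d M j = sylvester_nullity d M k + (j - k) * n" if "k \<le> j" for j
    using that
  proof (induction j rule: dec_induct)
    case (step j)
    then show ?case
      using \<delta>[of j] sylvester_nullity_Suc[of j] by (simp add: \<delta>_def Suc_diff_le)
  qed simp
  from this[OF assms(1) order_refl] show ?thesis .
qed

end

section \<open>Polynomial bases of rational subspaces\<close>

text \<open>Independence over the rational functions with denominators cleared, so that only
  polynomial coefficients occur. Likewise \<open>in_fract_span\<close> below is membership in the
  rational span, with \<open>g\<close> as the denominator.\<close>

definition poly_indep :: "nat \<Rightarrow> 'a::field poly vec list \<Rightarrow> bool" where
  "poly_indep q ws \<longleftrightarrow> (\<forall>b. (\<forall>c<q. (\<Sum>l<length ws. b l * ws ! l $ c) = 0) \<longrightarrow> (\<forall>l<length ws. b l = 0))"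

definition in_fract_span :: "nat \<Rightarrow> 'a::field poly vec list \<Rightarrow> 'a poly vec \<Rightarrow> bool" where
  "in_fract_span q ws v \<longleftrightarrow>
     (\<exists>g b. g \<noteq> 0 \<and> (\<forall>c<q. g * v $ c = (\<Sum>l<length ws. b l * ws ! l $ c)))"

lemma in_fract_span_nth:
  assumes "i < length ws"
  shows "in_fract_span q ws (ws ! i)"
proof -
  have "(\<Sum>l<length ws. (if l = i then 1 else 0) * ws ! l $ c) = 1 * ws ! i $ c" for c
  proof -
    have "(\<Sum>l<length ws. (if l = i then 1 else 0) * ws ! l $ c)
        = (\<Sum>l<length ws. if l = i then ws ! l $ c else 0)"
      by (intro sum.cong) auto
    then show ?thesis using assms by simp
  qed
  then show ?thesis unfolding in_fract_span_def
    by (intro exI[of _ 1] exI[of _ "\<lambda>l. if l = i then 1 else 0"]) simp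
qed

text \<open>By induction: the denominator \<open>y\<close> of the next element is multiplied into
  \<open>g\<close>.\<close>

lemma common_denominator:
  fixes a :: "nat \<Rightarrow> 'a::field poly fract"
  shows "\<exists>g b. g \<noteq> 0 \<and> (\<forall>l<N. to_fract g * a l = to_fract (b l))"
proof (induction N)
  case 0
  show ?case by (intro exI[of _ 1]) simp
next
  case (Suc N)
  then obtain g b where g: "g \<noteq> 0" "\<forall>l<N. to_fract g * a l = to_fract (b l)" by blast
  obtain x y where xy: "a N = Fract x y" "y \<noteq> 0" by (cases "a N")
  have N: "to_fract y * a N = to_fract x"
    using xy by (simp add: to_fract_def eq_fract)
  have "to_fract (g * y) * a l = to_fract (if l = N then g * x else y * b l)" if "l < Suc N" for l
  proof (cases "l = N")
    case True
    then show ?thesis using N by (simp add: mult.assoc)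
  next
    case False
    then have "to_fract g * a l = to_fract (b l)" using g(2) that by simp
    then have "to_fract y * (to_fract g * a l) = to_fract y * to_fract (b l)" by simp
    then show ?thesis using False by (simp add: mult_ac)
  qed
  then show ?case using g(1) xy(2)
    by (intro exI[of _ "g * y"] exI[of _ "\<lambda>l. if l = N then g * x else y * b l"]) simp
qed

lemma to_fract_sum: "to_fract (sum f A) = (\<Sum>a\<in>A. to_fract (f a))"
  by (induction A rule: infinite_finite_induct) simp_all

lemma mat_of_cols_mult_vec:
  fixes vs :: "'a::comm_ring_1 vec list"
  assumes "i < n" "set vs \<subseteq> carrier_vec n"
  shows "(mat_of_cols n vs *\<^sub>v vec (length vs) c) $ i = (\<Sum>l<length vs. c l * vs ! l $ i)"
  using assms by (auto simp: scalar_prod_def mat_of_cols_index lessThan_atLeast0 mult.commute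
      intro!: sum.cong)

lemma to_fract_mult_sum:
  fixes ws :: "'a::field poly vec list"
  assumes g: "g \<noteq> 0" "\<And>l. l < length ws \<Longrightarrow> to_fract g * a l = to_fract (b l)"
  shows "to_fract g * (\<Sum>l<length ws. a l * to_fract (ws ! l $ c))
    = to_fract (\<Sum>l<length ws. b l * ws ! l $ c)"
  using g(2) by (auto simp: to_fract_sum sum_distrib_left mult.assoc[symmetric] intro!: sum.cong)

text \<open>One direction multiplies a rational combination by a common denominator, the other
  divides the coefficients by \<open>g\<close>.\<close>

lemma in_span_to_fract_iff:
  fixes ws :: "'a::field poly vec list"
  assumes ws: "set ws \<subseteq> carrier_vec q" and v: "v \<in> carrier_vec q"
  shows "map_vec to_fract v \<in> LinearCombinations.module.span class_ring
      (module_vec TYPE('a poly fract) q) (map_vec to_fract ` set ws) \<longleftrightarrow> in_fract_span q ws v"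
proof -
  interpret vec_space "TYPE('a poly fract)" q .
  let ?F = "map_vec (to_fract :: 'a poly \<Rightarrow> _)"
  let ?vs = "map ?F ws"
  have vs: "set ?vs \<subseteq> carrier_vec q" using ws by auto
  have eq: "lincomb_list a ?vs = ?F v \<longleftrightarrow>
      (\<forall>c<q. (\<Sum>l<length ws. a l * to_fract (ws ! l $ c)) = to_fract (v $ c))" for a
  proof -
    have "lincomb_list a ?vs = mat_of_cols q ?vs *\<^sub>v vec (length ?vs) a"
      using vs by (intro lincomb_list_as_mat_mult) auto
    moreover have "(mat_of_cols q ?vs *\<^sub>v vec (length ?vs) a) $ c
        = (\<Sum>l<length ws. a l * to_fract (ws ! l $ c))" if "c < q" for c
    proof -
      have "dim_vec (ws ! l) = q" if "l < length ws" for l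
      using subsetD[OF ws nth_mem[OF that]] by simp
      then show ?thesis unfolding mat_of_cols_mult_vec[OF \<open>c < q\<close> vs]
        using \<open>c < q\<close> by (auto intro!: sum.cong)
    qed
    ultimately show ?thesis using v by (auto simp: vec_eq_iff)
  qed
  have "?F v \<in> span (?F ` set ws) \<longleftrightarrow> (\<exists>a. lincomb_list a ?vs = ?F v)"
    using span_list_as_span[OF vs] unfolding span_list_def by (auto simp: eq_commute)
  also have "\<dots> \<longleftrightarrow> in_fract_span q ws v"
  proof
    assume "\<exists>a. lincomb_list a ?vs = ?F v"
    then obtain a where a: "\<forall>c<q. (\<Sum>l<length ws. a l * to_fract (ws ! l $ c)) = to_fract (v $ c)"
      unfolding eq by blast
    obtain g b where g: "g \<noteq> 0" "\<forall>l<length ws. to_fract g * a l = to_fract (b l)"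
      using common_denominator by blast
    have "g * v $ c = (\<Sum>l<length ws. b l * ws ! l $ c)" if "c < q" for c
    proof -
      have "to_fract (g * v $ c) = to_fract (\<Sum>l<length ws. b l * ws ! l $ c)"
        using to_fract_mult_sum[of g ws a b c] g a that by simp
      then show ?thesis by (simp only: to_fract_eq_iff)
    qed
    then show "in_fract_span q ws v" unfolding in_fract_span_def using g(1) by blast
  next
    assume "in_fract_span q ws v"
    then obtain g b where g: "g \<noteq> 0" "\<forall>c<q. g * v $ c = (\<Sum>l<length ws. b l * ws ! l $ c)"
      unfolding in_fract_span_def by blast
    have "(\<Sum>l<length ws. to_fract (b l) / to_fract g * to_fract (ws ! l $ c)) = to_fract (v $ c)"
      if "c < q" for c
    proof -
      have "to_fract g * (\<Sum>l<length ws. to_fract (b l) / to_fract g * to_fract (ws ! l $ c))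
          = to_fract (g * v $ c)"
        using to_fract_mult_sum[of g ws "\<lambda>l. to_fract (b l) / to_fract g" b c] g that by simp
      then show ?thesis using g(1) by simp
    qed
    then show "\<exists>a. lincomb_list a ?vs = ?F v" unfolding eq
      by (intro exI[of _ "\<lambda>l. to_fract (b l) / to_fract g"]) blast
  qed
  finally show ?thesis .
qed

lemma inj_map_vec_to_fract: "inj (map_vec (to_fract :: 'a::field poly \<Rightarrow> _))"
proof (rule injI)
  fix x y :: "'a poly vec" assume *: "map_vec to_fract x = map_vec to_fract y"
  then have d: "dim_vec x = dim_vec y" by (metis index_map_vec(2))
  show "x = y"
  proof (rule eq_vecI)
    fix i assume "i < dim_vec y"
    then show "x $ i = y $ i" using arg_cong[OF *, of "\<lambda>v. v $ i"] d by simp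
  qed (fact d)
qed

text \<open>Coefficients 1 and -1 on two equal entries form a nontrivial relation. The result
  supplies the distinctness demanded by \<open>polynomial_basis\<close>.\<close>

lemma poly_indep_distinct:
  assumes "poly_indep q ws"
  shows "distinct ws"
proof (rule ccontr)
  assume "\<not> distinct ws"
  then obtain i j where ij: "i < length ws" "j < length ws" "i \<noteq> j" "ws ! i = ws ! j"
    by (auto simp: distinct_conv_nth)
  let ?b = "\<lambda>l. if l = i then 1 else if l = j then - 1 else (0 :: 'a poly)"
  have "(\<Sum>l<length ws. ?b l * ws ! l $ c) = 0" for c
  proof -
    have "(\<Sum>l<length ws. ?b l * ws ! l $ c) = (\<Sum>l\<in>{i, j}. ?b l * ws ! l $ c)"
      using ij by (intro sum.mono_neutral_right) auto
    then show ?thesis using ij by simp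
  qed
  then have "\<forall>l<length ws. ?b l = 0"
    by (intro assms[unfolded poly_indep_def, THEN spec, THEN mp] allI impI)
  then show False using ij(1) by (metis one_neq_zero)
qed

text \<open>A common denominator turns a rational kernel vector of the matrix with columns
  \<open>ws\<close> into a polynomial relation. Distinctness matters because the set of vectors
  forgets repetitions while the list does not.\<close>

lemma lin_indpt_to_fract_iff:
  fixes ws :: "'a::field poly vec list"
  assumes ws: "set ws \<subseteq> carrier_vec q" and dist: "distinct ws"
  shows "\<not> LinearCombinations.module.lin_dep class_ring
      (module_vec TYPE('a poly fract) q) (map_vec to_fract ` set ws) \<longleftrightarrow> poly_indep q ws"
proof -
  interpret vec_space "TYPE('a poly fract)" q .
  let ?F = "map_vec (to_fract :: 'a poly \<Rightarrow> _)"
  let ?vs = "map ?F ws"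
  have vs: "set ?vs \<subseteq> carrier_vec q" using ws by auto
  define A where "A = mat_of_cols q ?vs"
  have A: "A \<in> carrier_mat q (length ws)" 
    using mat_of_cols_carrier(1)[of q ?vs] by (simp add: A_def)
  have cols: "cols A = ?vs" unfolding A_def using vs by simp
  have distc: "distinct (cols A)"
    unfolding cols using dist inj_on_subset[OF inj_map_vec_to_fract subset_UNIV]
    by (simp add: distinct_map)
  have mult: "(A *\<^sub>v vec (length ws) a) $ c = (\<Sum>l<length ws. a l * to_fract (ws ! l $ c))"
    if "c < q" for a c
  proof -
    have "dim_vec (ws ! l) = q" if "l < length ws" for l
      using subsetD[OF ws nth_mem[OF that]] by simp
    then show ?thesis using mat_of_cols_mult_vec[OF \<open>c < q\<close> vs, of a]
      using \<open>c < q\<close> by (auto simp: A_def intro!: sum.cong)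
  qed
  have "lin_dep (?F ` set ws) \<longleftrightarrow> \<not> poly_indep q ws"
  proof
    assume "lin_dep (?F ` set ws)"
    then have "lin_dep (set (cols A))" using cols by simp
    then obtain v where v: "v \<in> carrier_vec (length ws)" "v \<noteq> 0\<^sub>v (length ws)" "A *\<^sub>v v = 0\<^sub>v q"
      using lin_depE[OF A _ distc] by blast
    obtain g b where g: "g \<noteq> 0" "\<forall>l<length ws. to_fract g * v $ l = to_fract (b l)"
      using common_denominator by blast
    have vv: "vec (length ws) (($) v) = v" using v(1) by auto
    have "(\<Sum>l<length ws. b l * ws ! l $ c) = 0" if "c < q" for c
    proof -
      have "(\<Sum>l<length ws. v $ l * to_fract (ws ! l $ c)) = 0"
        using mult[OF that, of "($) v"] v(3) that unfolding vv by simp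
      then have "to_fract (\<Sum>l<length ws. b l * ws ! l $ c) = 0"
        using to_fract_mult_sum[of g ws "($) v" b c] g by simp
      then show ?thesis by (simp only: to_fract_eq_0_iff)
    qed
    moreover obtain l where l: "l < length ws" "v $ l \<noteq> 0"
      using v(1,2) by (metis carrier_vecD eq_vecI index_zero_vec)
    moreover have "b l \<noteq> 0"
    proof
      assume "b l = 0"
      then have "to_fract g * v $ l = 0" using g(2) l(1) by simp
      then show False using g(1) l(2) by simp
    qed
    ultimately show "\<not> poly_indep q ws" unfolding poly_indep_def by blast
  next
    assume "\<not> poly_indep q ws"
    then obtain b l where b: "\<forall>c<q. (\<Sum>l<length ws. b l * ws ! l $ c) = 0" "l < length ws" "b l \<noteq> 0"
      unfolding poly_indep_def by blast
    let ?v = "vec (length ws) (\<lambda>l. to_fract (b l))"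
    have "?v $ l \<noteq> 0\<^sub>v (length ws) $ l" using b by simp
    then have "?v \<noteq> 0\<^sub>v (length ws)" by auto
    moreover have "A *\<^sub>v ?v = 0\<^sub>v q"
    proof (rule eq_vecI)
      fix c assume "c < dim_vec (0\<^sub>v q :: 'a poly fract vec)"
      then have c: "c < q" by simp
      have "(A *\<^sub>v ?v) $ c = to_fract (\<Sum>l<length ws. b l * ws ! l $ c)"
        unfolding mult[OF c] by (simp add: to_fract_sum)
      then show "(A *\<^sub>v ?v) $ c = 0\<^sub>v q $ c" using b(1) c by simp
    qed (use A in simp)
    ultimately have "lin_dep (set (cols A))" using lin_depI[OF A _ _ _ distc, of ?v] by simp
    then show "lin_dep (?F ` set ws)" using cols by simp
  qed
  then show ?thesis by blast
qed

text \<open>Moves the question from rational functions to polynomial arithmetic: the two spans agree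
  iff each list lies in the span of the other.\<close>

lemma polynomial_basis_span_iff:
  fixes ws xs :: "'a::field poly vec list"
  assumes xs: "set xs \<subseteq> carrier_vec q"
  defines "W \<equiv> LinearCombinations.module.span class_ring
      (module_vec TYPE('a poly fract) q) (map_vec to_fract ` set xs)"
  shows "polynomial_basis q W ws \<longleftrightarrow> set ws \<subseteq> carrier_vec q \<and> poly_indep q ws \<and>
    (\<forall>w\<in>set ws. in_fract_span q xs w) \<and> (\<forall>x\<in>set xs. in_fract_span q ws x)"
proof (cases "set ws \<subseteq> carrier_vec q \<and> distinct ws")
  case True
  then have ws: "set ws \<subseteq> carrier_vec q" and dist: "distinct ws" by auto
  interpret vec_space "TYPE('a poly fract)" q .
  let ?F = "map_vec (to_fract :: 'a poly \<Rightarrow> _)"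
  have c: "?F ` set ws \<subseteq> carrier_vec q" "?F ` set xs \<subseteq> carrier_vec q" using ws xs by auto
  have W: "W = span (?F ` set xs)" by (simp add: W_def)
  have sub: "submodule class_ring W V" unfolding W using span_is_submodule c(2) by simp
  then have vsW: "vectorspace class_ring (V\<lparr>carrier := W\<rparr>)"
    using subspace_is_vs subspace_def vec_vs by blast
  \<comment> \<open>Independence and span computed inside \<open>W\<close> agree with the ambient
    ones if the vectors lie in \<open>W\<close>; otherwise both sides fail.\<close>
  have bas: "vectorspace.basis class_ring (V\<lparr>carrier := W\<rparr>) (?F ` set ws) \<longleftrightarrow>
      lin_indpt (?F ` set ws) \<and> span (?F ` set ws) = W"
  proof (cases "?F ` set ws \<subseteq> W")
    case True
    then show ?thesis unfolding vectorspace.basis_def[OF vsW]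
      using span_li_not_depend[OF True sub] by simp
  next
    case False
    moreover from this have "span (?F ` set ws) \<noteq> W" using in_own_span[OF c(1)] by blast
    ultimately show ?thesis unfolding vectorspace.basis_def[OF vsW] by simp
  qed
  have eq: "span (?F ` set ws) = W \<longleftrightarrow> ?F ` set ws \<subseteq> span (?F ` set xs) \<and> ?F ` set xs \<subseteq> span (?F ` set ws)"
  proof
    assume "span (?F ` set ws) = W"
    then show "?F ` set ws \<subseteq> span (?F ` set xs) \<and> ?F ` set xs \<subseteq> span (?F ` set ws)"
      using in_own_span[OF c(1)] in_own_span[OF c(2)] W by auto
  next
    assume h: "?F ` set ws \<subseteq> span (?F ` set xs) \<and> ?F ` set xs \<subseteq> span (?F ` set ws)"
    show "span (?F ` set ws) = W"
      unfolding W by (rule equalityI[OF span_subsetI[OF c(2) conjunct1[OF h]]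
        span_subsetI[OF c(1) conjunct2[OF h]]])
  qed
  have sp: "?F ` set ws \<subseteq> span (?F ` set xs) \<longleftrightarrow> (\<forall>w\<in>set ws. in_fract_span q xs w)"
    "?F ` set xs \<subseteq> span (?F ` set ws) \<longleftrightarrow> (\<forall>x\<in>set xs. in_fract_span q ws x)"
    using in_span_to_fract_iff[OF xs] in_span_to_fract_iff[OF ws] ws xs
    by (auto simp: image_subset_iff subset_iff)
  show ?thesis unfolding polynomial_basis_def bas eq sp
    using ws dist lin_indpt_to_fract_iff[OF ws dist] by blast
next
  case False
  then show ?thesis using poly_indep_distinct unfolding polynomial_basis_def by blast
qed

text \<open>Both lengths are the dimension of \<open>W\<close>: the lists are distinct and
  \<open>map_vec to_fract\<close> is injective, so lengths are cardinalities of bases.\<close>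

lemma polynomial_basis_length:
  fixes ws xs :: "'a::field poly vec list"
  assumes ws: "polynomial_basis q W ws" and xs: "polynomial_basis q W xs"
    and W: "vectorspace class_ring (module_vec TYPE('a poly fract) q\<lparr>carrier := W\<rparr>)"
  shows "length ws = length xs"
proof -
  have "vectorspace.dim class_ring (module_vec TYPE('a poly fract) q\<lparr>carrier := W\<rparr>) = length us"
    if "polynomial_basis q W us" for us :: "'a poly vec list"
  proof -
    have "vectorspace.dim class_ring (module_vec TYPE('a poly fract) q\<lparr>carrier := W\<rparr>)
        = card (map_vec to_fract ` set us)"
      using that vectorspace.dim_basis[OF W] unfolding polynomial_basis_def by simp
    also have "\<dots> = card (set us)"
      by (intro card_image inj_on_subset[OF inj_map_vec_to_fract subset_UNIV])
    also have "\<dots> = length us" using that unfolding polynomial_basis_def by (simp add: distinct_card)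
    finally show ?thesis .
  qed
  then show ?thesis using ws xs by metis
qed

section \<open>Minimal bases have a polynomial right inverse\<close>

lemma vec_degree_le: "(\<And>c. c < dim_vec w \<Longrightarrow> degree (w $ c) \<le> D) \<Longrightarrow> vec_degree w \<le> D"
  unfolding vec_degree_def by (intro Max.boundedI) auto

lemma degree_le_vec_degree: "c < dim_vec w \<Longrightarrow> degree (w $ c) \<le> vec_degree w"
  unfolding vec_degree_def by (intro Max_ge) auto

text \<open>Euclidean division: a nonzero element of least degree divides all others, since a
  nonzero remainder would lie in \<open>J\<close> and have smaller degree.\<close>

lemma poly_ideal_generator:
  fixes J :: "'a::field poly set"
  assumes "0 \<in> J" and add: "\<And>x y. x \<in> J \<Longrightarrow> y \<in> J \<Longrightarrow> x + y \<in> J"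
    and mult: "\<And>a x. x \<in> J \<Longrightarrow> a * x \<in> J"
  obtains g where "g \<in> J" "\<And>x. x \<in> J \<Longrightarrow> g dvd x"
proof (cases "J \<subseteq> {0}")
  case True
  then show ?thesis using that[of 0] assms(1) by auto
next
  case False
  then obtain g where g: "g \<in> J" "g \<noteq> 0"
    and least: "\<And>h. h \<in> J \<and> h \<noteq> 0 \<Longrightarrow> degree g \<le> degree h"
    using ex_has_least_nat[of "\<lambda>h. h \<in> J \<and> h \<noteq> 0" _ degree] by blast
  have "g dvd x" if "x \<in> J" for x
  proof (rule ccontr)
    assume "\<not> g dvd x"
    then have "x mod g \<noteq> 0" by (simp add: dvd_eq_mod_eq_0)
    moreover have "x mod g = x + (- (x div g)) * g" by (simp add: minus_div_mult_eq_mod[symmetric])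
    then have "x mod g \<in> J" using add[OF that mult[OF g(1)]] by metis
    ultimately show False
      using least[of "x mod g"] degree_mod_less'[OF g(2), of x] by simp
  qed
  then show ?thesis using that[OF g(1)] by blast
qed

context poly_mat
begin

section \<open>Minimality expressed by polynomial combinations of the rows\<close>

definition row_indep :: bool where
  "row_indep \<longleftrightarrow> (\<forall>b. (\<forall>c<q. mult_row b c = 0) \<longrightarrow> (\<forall>s<m. b s = 0))"

lemma rows_carrier: "set (rows M) \<subseteq> carrier_vec q"
  using M by (auto simp: rows_def)

lemma poly_indep_rows: "poly_indep q (rows M) \<longleftrightarrow> row_indep"
  unfolding poly_indep_def row_indep_def using M by (simp add: mult_row_def)

lemma in_fract_span_rows:
  "in_fract_span q (rows M) v \<longleftrightarrow> (\<exists>g b. g \<noteq> 0 \<and> (\<forall>c<q. g * v $ c = mult_row b c))"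
  unfolding in_fract_span_def using M by (simp add: mult_row_def)

lemma sum_list_row_degrees: "sum_list (map vec_degree (rows M)) = (\<Sum>s<m. rdeg s)"
  using M by (simp add: sum_list_sum_nth row_degree_def lessThan_atLeast0)

lemma minimal_basis_mat_alt:
  defines "P \<equiv> \<lambda>ws. set ws \<subseteq> carrier_vec q \<and> poly_indep q ws \<and>
    (\<forall>w\<in>set ws. in_fract_span q (rows M) w) \<and> (\<forall>x\<in>set (rows M). in_fract_span q ws x)"
  shows "minimal_basis_mat M \<longleftrightarrow> m < q \<and> row_indep \<and>
    (\<forall>ws. P ws \<longrightarrow> (\<Sum>s<m. rdeg s) \<le> sum_list (map vec_degree ws))"
proof -
  have dim: "dim_row M = m" "dim_col M = q" using M by auto
  have "P (rows M) \<longleftrightarrow> row_indep"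
    unfolding P_def poly_indep_rows using rows_carrier in_fract_span_nth
    by (metis in_set_conv_nth)
  then show ?thesis
    unfolding minimal_basis_mat_def minimal_basis_of_def dim polynomial_basis_span_iff[OF rows_carrier]
      sum_list_row_degrees P_def by blast
qed

lemma minimal_row_indep: "minimal_basis_mat M \<Longrightarrow> row_indep"
  using minimal_basis_mat_alt by blast

text \<open>If \<open>w\<close> is a combination of the rows which involves row \<open>i\<close>, then replacing row \<open>i\<close> by \<open>w\<close>
  yields another polynomial basis, so \<open>w\<close> cannot have smaller degree than row \<open>i\<close>.\<close>

lemma minimal_exchange:
  assumes min: "minimal_basis_mat M" and g: "g \<noteq> 0" and i: "i < m" and bi: "b i \<noteq> 0"
    and w: "w \<in> carrier_vec q" "\<And>c. c < q \<Longrightarrow> g * w $ c = mult_row b c"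
  shows "rdeg i \<le> vec_degree w"
proof -
  let ?ws = "(rows M)[i := w]"
  have len: "length ?ws = m" "length (rows M) = m" using M by auto
  have nth: "?ws ! l = (if l = i then w else row M l)" if "l < m" for l
    using that i len M by (simp add: nth_list_update)
  have split: "(\<Sum>l<m. f l) = f i + (\<Sum>l\<in>{..<m} - {i}. f l)" for f :: "nat \<Rightarrow> 'a poly"
    using i by (intro sum.remove) auto
  have sum_ws: "(\<Sum>l<length ?ws. e l * ?ws ! l $ c)
      = e i * w $ c + (\<Sum>l\<in>{..<m} - {i}. e l * M $$ (l, c))" if "c < q" for e c
  proof -
    have "(\<Sum>l\<in>{..<m} - {i}. e l * ?ws ! l $ c) = (\<Sum>l\<in>{..<m} - {i}. e l * M $$ (l, c))"
      using M that by (intro sum.cong) (auto simp: nth)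
    then show ?thesis unfolding len split[of "\<lambda>l. e l * ?ws ! l $ c"] using nth[OF i] by simp
  qed
  have row: "mult_row e c = e i * M $$ (i, c) + (\<Sum>l\<in>{..<m} - {i}. e l * M $$ (l, c))" for e c
    unfolding mult_row_def by (rule split)
  have indep: row_indep using min by (rule minimal_row_indep)
  have "poly_indep q ?ws"
    unfolding poly_indep_def
  proof (intro allI impI)
    fix e l assume e: "\<forall>c<q. (\<Sum>l<length ?ws. e l * ?ws ! l $ c) = 0" and l: "l < length ?ws"
    \<comment> \<open>Multiplying the relation \<open>e\<close> by \<open>g\<close> and substituting
      \<open>g w = b M\<close> gives a relation \<open>b'\<close> among the original rows. Its entry
      at \<open>i\<close> is \<open>e i * b i\<close>, so \<open>b i \<noteq> 0\<close> forces
      \<open>e i = 0\<close>.\<close>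
    define b' where "b' l = (if l = i then e i * b i else g * e l + e i * b l)" for l
    have "mult_row b' c = 0" if c: "c < q" for c
    proof -
      have "mult_row b' c = e i * b i * M $$ (i, c)
          + (\<Sum>l\<in>{..<m} - {i}. g * (e l * M $$ (l, c)) + e i * (b l * M $$ (l, c)))"
        unfolding row by (auto simp: b'_def algebra_simps intro!: arg_cong2[where f="(+)"] sum.cong)
      also have "\<dots> = g * (\<Sum>l\<in>{..<m} - {i}. e l * M $$ (l, c)) + e i * mult_row b c"
        unfolding row by (simp add: sum.distrib sum_distrib_left algebra_simps)
      also have "\<dots> = g * (e i * w $ c + (\<Sum>l\<in>{..<m} - {i}. e l * M $$ (l, c)))"
        by (simp add: w(2)[OF c, symmetric] algebra_simps)
      also have "\<dots> = 0" using e[rule_format, OF c, unfolded sum_ws[OF c]] by simp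
      finally show ?thesis .
    qed
    then have b'0: "\<forall>s<m. b' s = 0" using indep unfolding row_indep_def by blast
    then have "e i = 0" using i bi by (auto simp: b'_def)
    then show "e l = 0" using b'0 l len g by (cases "l = i") (auto simp: b'_def)
  qed
  moreover have "set ?ws \<subseteq> carrier_vec q"
    using set_update_subset_insert[of "rows M" i w] rows_carrier w(1) by blast
  moreover have "in_fract_span q (rows M) v" if "v \<in> set ?ws" for v
  proof -
    have "v = w \<or> v \<in> set (rows M)" using that set_update_subset_insert[of "rows M" i w] by blast
    then show ?thesis
    proof
      assume "v = w"
      then show ?thesis unfolding in_fract_span_rows using g w(2) by blast
    next
      assume "v \<in> set (rows M)"
      then show ?thesis using in_fract_span_nth by (metis in_set_conv_nth)
    qed
  qed
  moreover have "in_fract_span q ?ws x" if x: "x \<in> set (rows M)" for x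
  proof -
    obtain l where l: "l < m" "x = row M l" using x M by (auto simp: rows_def)
    show ?thesis
    proof (cases "l = i")
      case False
      then show ?thesis using in_fract_span_nth[of l ?ws] l len nth by simp
    next
      case True
      \<comment> \<open>Row \<open>i\<close> is recovered by solving \<open>g w = b M\<close> for
        its term, with \<open>b i\<close> as the denominator.\<close>
      have "b i * x $ c = (\<Sum>l<length ?ws. (if l = i then g else - b l) * ?ws ! l $ c)"
        if c: "c < q" for c
      proof -
        have "(\<Sum>l<length ?ws. (if l = i then g else - b l) * ?ws ! l $ c)
            = g * w $ c + (\<Sum>l\<in>{..<m} - {i}. - (b l * M $$ (l, c)))"
          unfolding sum_ws[OF c] by (intro arg_cong2[where f = "(+)"] sum.cong) simp_all
        also have "\<dots> = b i * M $$ (i, c)"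
          unfolding w(2)[OF c] row by (simp add: sum_negf)
        finally show ?thesis using True l M c by simp
      qed
      then show ?thesis unfolding in_fract_span_def using bi
        by (intro exI[of _ "b i"] exI[of _ "\<lambda>l. if l = i then g else - b l"]) simp
    qed
  qed
  ultimately have "(\<Sum>s<m. rdeg s) \<le> sum_list (map vec_degree ?ws)"
    using min unfolding minimal_basis_mat_alt by blast
  also have "\<dots> = sum_list (map vec_degree (rows M)) + vec_degree w - rdeg i"
    using i len M by (simp add: map_update sum_list_update row_degree_def)
  finally have le: "(\<Sum>s<m. rdeg s) \<le> (\<Sum>s<m. rdeg s) + vec_degree w - rdeg i"
    unfolding sum_list_row_degrees .
  \<comment> \<open>Ensures that the natural number subtraction above is not truncated.\<close>
  have "rdeg i \<le> (\<Sum>s<m. rdeg s)" using i by (intro member_le_sum) auto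
  then show ?thesis using le by linarith
qed

text \<open>Writing \<open>deg w < rdeg i\<close> as vanishing coefficients covers
  \<open>rdeg i = 0\<close> too: there it means \<open>w = 0\<close>, against independence of the
  rows. Otherwise it contradicts the exchange argument.\<close>

lemma minimal_exchange_coeff:
  assumes min: "minimal_basis_mat M" and g: "g \<noteq> 0" and i: "i < m" and bi: "b i \<noteq> 0"
    and w: "\<And>c. c < q \<Longrightarrow> g * w c = mult_row b c"
    and small: "\<And>c j. c < q \<Longrightarrow> rdeg i \<le> j \<Longrightarrow> coeff (w c) j = 0"
  shows False
proof (cases "rdeg i = 0")
  case True
  then have "w c = 0" if "c < q" for c using small[OF that] by (intro poly_eqI) simp
  then have "\<forall>c<q. mult_row b c = 0" using w by (metis mult_zero_right)
  then show False using minimal_row_indep[OF min] i bi unfolding row_indep_def by blast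
next
  case False
  have "vec_degree (vec q w) \<le> rdeg i - 1"
    using small False by (intro vec_degree_le) (auto intro!: Polynomial.degree_le)
  moreover have "rdeg i \<le> vec_degree (vec q w)"
    using w by (intro minimal_exchange[where b = b, OF min g i bi]) auto
  ultimately show False using False by simp
qed

text \<open>Among the rows with \<open>a l \<noteq> 0\<close> let row \<open>i\<close> have the
  largest degree. Scaling row \<open>l\<close> by \<open>a l\<close> times
  \<open>\<lambda>^(rdeg i - rdeg l)\<close> aligns the top coefficients, which then cancel in the
  sum. So a combination involving row \<open>i\<close> has degree below \<open>rdeg i\<close>,
  against minimality.\<close>

lemma minimal_hr_indep:
  assumes min: "minimal_basis_mat M"
    and c: "\<And>j. j < q \<Longrightarrow> (\<Sum>i<m. a i * coeff (M $$ (i, j)) (rdeg i)) = 0"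
  shows "\<forall>i<m. a i = 0"
proof (rule ccontr)
  let ?I = "{i. i < m \<and> a i \<noteq> 0}"
  assume "\<not> (\<forall>i<m. a i = 0)"
  then have I: "finite ?I" "?I \<noteq> {}" by auto
  obtain i where i: "i < m" "a i \<noteq> 0" and max: "\<And>l. l < m \<Longrightarrow> a l \<noteq> 0 \<Longrightarrow> rdeg l \<le> rdeg i"
  proof -
    obtain i where "i \<in> ?I" "rdeg i = Max (rdeg ` ?I)"
      using Max_in[of "rdeg ` ?I"] I by (metis (no_types, lifting) finite_imageI image_iff image_is_empty)
    then show ?thesis using that[of i] I by auto
  qed
  define b where "b l = monom (a l) (rdeg i - rdeg l)" for l
  show False
  proof (rule minimal_exchange_coeff[OF min, of 1 i b "mult_row b"])
    show "b i \<noteq> 0" using i by (simp add: b_def)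
    fix c' j assume c': "c' < q" and j: "rdeg i \<le> j"
    have "coeff (b l * M $$ (l, c')) j
        = (if j = rdeg i then a l * coeff (M $$ (l, c')) (rdeg l) else 0)" if l: "l < m" for l
    proof (cases "a l = 0")
      case False
      then have le: "rdeg l \<le> rdeg i" using max l by blast
      show ?thesis
      proof (cases "j = rdeg i")
        case True
        then show ?thesis using le by (simp add: b_def coeff_monom_mult)
      next
        case False
        then have "rdeg l < j - (rdeg i - rdeg l)" using j le by linarith
        then show ?thesis using False l c' by (simp add: b_def coeff_monom_mult coeff_above_rdeg)
      qed
    qed (simp add: b_def)
    then have "coeff (mult_row b c') j
        = (\<Sum>l<m. if j = rdeg i then a l * coeff (M $$ (l, c')) (rdeg l) else 0)"
      unfolding mult_row_def coeff_sum by (intro sum.cong) auto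
    then show "coeff (mult_row b c') j = 0" using c[OF c'] by (cases "j = rdeg i") auto
  qed (use i in auto)
qed

text \<open>Reduce \<open>y\<close> modulo \<open>g\<close> to \<open>b\<close>; then
  \<open>g\<close> still divides \<open>b M\<close>. If \<open>b\<close> were nonzero, let row
  \<open>i\<close> have the largest degree among the rows involved. As \<open>deg b < deg g\<close>,
  the quotient of \<open>b M\<close> by \<open>g\<close> has degree below \<open>rdeg i\<close>, and
  it could replace row \<open>i\<close>.\<close>

lemma minimal_saturated:
  assumes min: "minimal_basis_mat M" and dvd: "\<And>c. c < q \<Longrightarrow> g dvd mult_row y c" and s: "s < m"
  shows "g dvd y s"
proof (cases "g = 0")
  case True
  then have "\<forall>c<q. mult_row y c = 0" using dvd by simp
  then have "y s = 0" using minimal_row_indep[OF min] s unfolding row_indep_def by blast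
  then show ?thesis by simp
next
  case g: False
  define b where "b l = y l mod g" for l
  have "b l = 0" if l: "l < m" for l
  proof (rule ccontr)
    let ?I = "{i. i < m \<and> b i \<noteq> 0}"
    assume "b l \<noteq> 0"
    then have I: "finite ?I" "?I \<noteq> {}" using l by auto
    obtain i where i: "i < m" "b i \<noteq> 0" and max: "\<And>l. l < m \<Longrightarrow> b l \<noteq> 0 \<Longrightarrow> rdeg l \<le> rdeg i"
    proof -
      obtain i where "i \<in> ?I" "rdeg i = Max (rdeg ` ?I)"
        using Max_in[of "rdeg ` ?I"] I by (metis (no_types, lifting) finite_imageI image_iff image_is_empty)
      then show ?thesis using that[of i] I by auto
    qed
    have "mult_row b c = mult_row y c - g * mult_row (\<lambda>l. y l div g) c" for c
      unfolding mult_row_def b_def sum_distrib_left sum_subtractf[symmetric]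
      by (intro sum.cong) (simp_all add: minus_mult_div_eq_mod[symmetric] algebra_simps)
    then have gb: "g dvd mult_row b c" if "c < q" for c using dvd[OF that] by simp
    have deg_b: "degree (b l) < degree g" if "b l \<noteq> 0" for l
      using degree_mod_less'[OF g, of "y l"] that by (simp add: b_def)
    show False
    proof (rule minimal_exchange_coeff[where b = b and w = "\<lambda>c. mult_row b c div g", OF min g i])
      fix c assume "c < q"
      then show "g * (mult_row b c div g) = mult_row b c" using gb by simp
    next
      fix c j assume c: "c < q" and j: "rdeg i \<le> j"
      let ?w = "mult_row b c div g"
      show "coeff ?w j = 0"
      proof (cases "?w = 0")
        case False
        have "degree (b l * M $$ (l, c)) \<le> degree g - 1 + rdeg i" if "l < m" for l
        proof (cases "b l = 0")
          case False
          then have "degree (b l * M $$ (l, c)) \<le> degree (b l) + rdeg i"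
            using degree_mult_le[of "b l" "M $$ (l, c)"] degree_le_rdeg[OF that c] max[OF that] by linarith
          then show ?thesis using deg_b[OF False] by linarith
        qed simp
        then have "degree (mult_row b c) \<le> degree g - 1 + rdeg i"
          unfolding mult_row_def by (intro degree_sum_le) auto
        moreover have "degree (mult_row b c) = degree g + degree ?w"
          using gb[OF c] degree_mult_eq[OF g False] by simp
        \<comment> \<open>A nonzero remainder exists, so \<open>g\<close> is not constant and
          \<open>degree g - 1\<close> is a true predecessor.\<close>
        moreover have "degree g > 0" using deg_b[OF i(2)] by simp
        ultimately have "degree ?w < rdeg i" by linarith
        then show ?thesis using j by (intro coeff_eq_0) simp
      qed simp
    qed
  qed
  then show ?thesis using s by (simp add: b_def dvd_eq_mod_eq_0)
qed

section \<open>Right inverses of saturated matrices\<close>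

lemma mult_col_smult: "mult_col (\<lambda>c. a * p c) s = a * mult_col p s"
  unfolding mult_col_def by (simp add: sum_distrib_left mult.left_commute)

lemma mult_col_add: "mult_col (\<lambda>c. p c + p' c) s = mult_col p s + mult_col p' s"
  unfolding mult_col_def by (simp add: sum.distrib algebra_simps)

lemma mult_col_diff: "mult_col (\<lambda>c. p c - p' c) s = mult_col p s - mult_col p' s"
  unfolding mult_col_def by (simp add: sum_subtractf algebra_simps)

lemma mult_col_sum: "mult_col (\<lambda>c. \<Sum>l\<in>A. p l c) s = (\<Sum>l\<in>A. mult_col (p l) s)"
  unfolding mult_col_def by (simp add: sum_distrib_left sum.swap[of _ A])

lemma mult_col_unit: "c < q \<Longrightarrow> mult_col (\<lambda>c'. if c' = c then 1 else 0) s = M $$ (s, c)"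
  unfolding mult_col_def by (simp add: if_distrib cong: if_cong)

lemma mult_col_zero [simp]: "mult_col (\<lambda>c. 0) s = 0"
  unfolding mult_col_def by simp

text \<open>The vectors \<open>R l\<close> are the columns of a right inverse of the first
  \<open>n\<close> rows of \<open>M\<close>; the parameter \<open>n\<close> serves an induction over
  the rows.\<close>

definition right_inverse :: "nat \<Rightarrow> (nat \<Rightarrow> nat \<Rightarrow> 'a poly) \<Rightarrow> bool" where
  "right_inverse n R \<longleftrightarrow> (\<forall>l<n. \<forall>s<n. mult_col (R l) s = (if s = l then 1 else 0))"

text \<open>Induction over the rows. A new column has to vanish on the earlier rows and give 1 on
  row \<open>n\<close>; saturation shows that the ideal of attainable values contains 1.\<close>

lemma right_inverse_if_saturated:
  assumes sat: "\<And>g y s. (\<And>c. c < q \<Longrightarrow> g dvd mult_row y c) \<Longrightarrow> s < m \<Longrightarrow> g dvd y s"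
    and "n \<le> m"
  shows "\<exists>R. right_inverse n R"
  using \<open>n \<le> m\<close>
proof (induction n)
  case 0
  show ?case by (simp add: right_inverse_def)
next
  case (Suc n)
  then obtain R where R: "\<And>l s. l < n \<Longrightarrow> s < n \<Longrightarrow> mult_col (R l) s = (if s = l then 1 else 0)"
    unfolding right_inverse_def by auto
  have n: "n < m" using Suc.prems by simp
  \<comment> \<open>The ideal of values that row \<open>n\<close> takes on the kernel of the rows
    before it.\<close>
  define J where "J = {mult_col p n | p. \<forall>s<n. mult_col p s = 0}"
  have J0: "0 \<in> J" unfolding J_def by (auto intro!: exI[of _ "\<lambda>c. 0"])
  have J1: "x + y \<in> J" if xy: "x \<in> J" "y \<in> J" for x y
  proof -
    obtain p p' where "x = mult_col p n" "y = mult_col p' n"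
      "\<forall>s<n. mult_col p s = 0" "\<forall>s<n. mult_col p' s = 0" using xy unfolding J_def by blast
    then show ?thesis unfolding J_def
      by (auto simp: mult_col_add intro!: exI[of _ "\<lambda>c. p c + p' c"])
  qed
  have J2: "a * x \<in> J" if x: "x \<in> J" for a x
  proof -
    obtain p where "x = mult_col p n" "\<forall>s<n. mult_col p s = 0" using x unfolding J_def by blast
    then show ?thesis unfolding J_def
      by (auto simp: mult_col_smult intro!: exI[of _ "\<lambda>c. a * p c"])
  qed
  obtain g where g: "g \<in> J" "\<And>x. x \<in> J \<Longrightarrow> g dvd x"
    using poly_ideal_generator[OF J0 J1 J2] by blast
  \<comment> \<open>The combination \<open>y M\<close> is row \<open>n\<close> minus the combination
    of earlier rows that has the same values on the columns \<open>R l\<close>; hence it vanishes on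
    those columns.\<close>
  define y where "y s = (if s = n then 1 else if s < n then - mult_col (R s) n else 0)" for s
  have "g dvd mult_row y c" if c: "c < q" for c
  proof (rule g(2))
    \<comment> \<open>The unit vector at \<open>c\<close>, corrected by the columns
      \<open>R l\<close> so that it lies in the kernel of the first \<open>n\<close> rows. Its value
      on row \<open>n\<close> is entry \<open>c\<close> of \<open>y M\<close>, which therefore lies
      in \<open>J\<close>.\<close>
    define p where "p c' = (if c' = c then 1 else 0) - (\<Sum>l<n. M $$ (l, c) * R l c')" for c'
    have p: "mult_col p s = M $$ (s, c) - (\<Sum>l<n. M $$ (l, c) * mult_col (R l) s)" for s
      unfolding p_def mult_col_diff mult_col_sum mult_col_smult mult_col_unit[OF c] ..
    have "mult_col p s = 0" if "s < n" for s
    proof -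
      have "(\<Sum>l<n. M $$ (l, c) * mult_col (R l) s) = (\<Sum>l<n. if l = s then M $$ (l, c) else 0)"
        using R that by (intro sum.cong) auto
      then show ?thesis unfolding p using that by simp
    qed
    moreover have "mult_row y c = mult_col p n"
    proof -
      have "mult_row y c = (\<Sum>s<Suc n. y s * M $$ (s, c))"
        unfolding mult_row_def using n by (intro sum.mono_neutral_right) (auto simp: y_def)
      also have "\<dots> = M $$ (n, c) + (\<Sum>s<n. - (M $$ (s, c) * mult_col (R s) n))"
        by (simp add: y_def mult.commute)
      finally show ?thesis unfolding p by (simp add: sum_negf)
    qed
    ultimately show "mult_row y c \<in> J" unfolding J_def by blast
  qed
  then have "g dvd y n" by (rule sat[OF _ n])
  then have "g dvd 1" by (simp add: y_def)
  then obtain h where h: "1 = g * h" by (rule dvdE)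
  have "h * g \<in> J" using J2[OF g(1)] .
  then have "1 \<in> J" using h by (simp add: mult.commute)
  then obtain p where p: "mult_col p n = 1" "\<And>s. s < n \<Longrightarrow> mult_col p s = 0"
    unfolding J_def by auto
  \<comment> \<open>Subtracting a multiple of \<open>p\<close> from the old columns makes them
    vanish on row \<open>n\<close> and leaves their values on the earlier rows unchanged.\<close>
  define R' where "R' l = (if l = n then p else (\<lambda>c. R l c - mult_col (R l) n * p c))" for l
  have "mult_col (R' l) s = (if s = l then 1 else 0)" if "l < Suc n" "s < Suc n" for l s
    using that R[of l s] p by (cases "l = n"; cases "s = n")
      (auto simp: R'_def mult_col_diff mult_col_smult)
  then show ?case unfolding right_inverse_def by blast
qed

lemma minimal_right_inverse:
  assumes "minimal_basis_mat M"
  shows "\<exists>R. right_inverse m R"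
proof (rule right_inverse_if_saturated)
  show "g dvd y s" if "\<And>c. c < q \<Longrightarrow> g dvd mult_row y c" "s < m" for g y s
    using that by (rule minimal_saturated[OF assms])
qed simp

end

section \<open>Full image of the Sylvester matrices\<close>

lemma coeff_mult_degree_bound:
  assumes "degree p \<le> a" "degree r \<le> b"
  shows "coeff (p * r) (a + b) = coeff p a * coeff r b"
proof -
  have "coeff p i * coeff r (a + b - i) = (if i = a then coeff p a * coeff r b else 0)"
    if "i \<le> a + b" for i
  proof (cases "i < a")
    case True
    then have "coeff r (a + b - i) = 0" using assms by (intro coeff_eq_0) linarith
    then show ?thesis using True by simp
  next
    case False
    then show ?thesis using assms by (cases "i = a") (auto simp: coeff_eq_0)
  qed
  then show ?thesis unfolding coeff_mult by simp
qed

text \<open>Some summand of the Leibniz formula is nonzero, hence so are all its factors.\<close>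

lemma det_nonzero_permutation:
  fixes A :: "'a::idom mat"
  assumes A: "A \<in> carrier_mat n n" and "det A \<noteq> 0"
  obtains p where "p permutes {0..<n}" "\<And>i. i < n \<Longrightarrow> A $$ (i, p i) \<noteq> 0"
proof -
  have "\<exists>p. p permutes {0..<n} \<and> signof p * (\<Prod>i = 0..<n. A $$ (i, p i)) \<noteq> 0"
  proof (rule ccontr)
    assume "\<not> ?thesis"
    then have "det A = 0" unfolding det_def'[OF A] by (intro sum.neutral) blast
    then show False using assms(2) by simp
  qed
  then obtain p where "p permutes {0..<n}" "(\<Prod>i = 0..<n. A $$ (i, p i)) \<noteq> 0" by auto
  then show ?thesis using that[of p] by auto
qed

context poly_mat
begin

section \<open>The highest row degree matrix and the degrees of row combinations\<close>

lemma hr_carrier: "highest_row_degree_mat M \<in> carrier_mat m q"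
  using M by (simp add: highest_row_degree_mat_def)

lemma hr_entry: "s < m \<Longrightarrow> c < q \<Longrightarrow> highest_row_degree_mat M $$ (s, c) = coeff (M $$ (s, c)) (rdeg s)"
  using M by (simp add: highest_row_degree_mat_def)

lemma hr_surj:
  assumes "mat_rank (highest_row_degree_mat M) = m"
  obtains v where "\<And>s. s < m \<Longrightarrow> (\<Sum>c<q. coeff (M $$ (s, c)) (rdeg s) * v c) = u s"
proof -
  obtain v where v: "v \<in> carrier_vec q" "highest_row_degree_mat M *\<^sub>v v = vec m u"
    using assms mat_rank_eq_dim_row_iff[OF hr_carrier] vec_carrier by blast
  have "(\<Sum>c<q. coeff (M $$ (s, c)) (rdeg s) * v $ c) = u s" if s: "s < m" for s
  proof -
    have "(highest_row_degree_mat M *\<^sub>v v) $ s = (\<Sum>c<q. coeff (M $$ (s, c)) (rdeg s) * v $ c)"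
      using s v(1) hr_carrier by (auto simp: scalar_prod_def hr_entry lessThan_atLeast0 intro!: sum.cong)
    then show ?thesis using v(2) s by simp
  qed
  then show ?thesis using that by blast
qed

text \<open>Full row rank makes the matrix onto. Pairing the relation \<open>a\<close> with a
  preimage \<open>v\<close> of the unit vector at \<open>i\<close> isolates
  \<open>a i\<close>.\<close>

lemma hr_indep:
  assumes rank: "mat_rank (highest_row_degree_mat M) = m"
    and a: "\<And>c. c < q \<Longrightarrow> (\<Sum>s<m. a s * coeff (M $$ (s, c)) (rdeg s)) = 0" and i: "i < m"
  shows "a i = 0"
proof -
  obtain v where v: "\<And>s. s < m \<Longrightarrow>
      (\<Sum>c<q. coeff (M $$ (s, c)) (rdeg s) * v c) = (if s = i then 1 else 0)"
    using hr_surj[OF rank, of "\<lambda>s. if s = i then 1 else 0"] by blast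
  have "a i = (\<Sum>s<m. if s = i then a s else 0)" using i by simp
  also have "\<dots> = (\<Sum>s<m. a s * (\<Sum>c<q. coeff (M $$ (s, c)) (rdeg s) * v c))"
    by (intro sum.cong) (auto simp: v)
  also have "\<dots> = (\<Sum>c<q. \<Sum>s<m. a s * coeff (M $$ (s, c)) (rdeg s) * v c)"
    by (simp add: sum_distrib_left mult.assoc sum.swap[of _ "{..<m}"])
  also have "\<dots> = (\<Sum>c<q. (\<Sum>s<m. a s * coeff (M $$ (s, c)) (rdeg s)) * v c)"
    by (simp add: sum_distrib_right)
  also have "\<dots> = 0" using a by simp
  finally show ?thesis .
qed

lemma minimal_rank_hr:
  assumes "minimal_basis_mat M"
  shows "mat_rank (highest_row_degree_mat M) = m"
proof (rule mat_rank_full_row_rankI[OF hr_carrier])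
  show "m \<le> q" using assms minimal_basis_mat_alt by simp
  fix c :: "'a vec" assume c: "c \<in> carrier_vec m"
    and "\<And>j. j < q \<Longrightarrow> (\<Sum>i<m. c $ i * highest_row_degree_mat M $$ (i, j)) = 0"
  then have "\<forall>i<m. c $ i = 0"
    by (intro minimal_hr_indep[OF assms]) (simp add: hr_entry)
  then show "c = 0\<^sub>v m" using c by auto
qed

text \<open>The top coefficients of a target vector are removed one at a time, using that the highest
  row degree matrix is onto; what remains is handled by the right inverse.\<close>

lemma full_image_large:
  assumes rank: "mat_rank (highest_row_degree_mat M) = m" and R: "right_inverse m R"
  shows "\<exists>K. \<forall>k\<ge>K. full_image k"
proof -
  define \<rho> where "\<rho> = (\<Sum>l<m. \<Sum>c<q. degree (R l c))"
  have \<rho>: "degree (R l c) \<le> \<rho>" if "l < m" "c < q" for l c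
  proof -
    have "degree (R l c) \<le> (\<Sum>c<q. degree (R l c))" using that by (intro member_le_sum) auto
    also have "\<dots> \<le> \<rho>" unfolding \<rho>_def using that
      by (intro member_le_sum[of l "{..<m}" "\<lambda>l. \<Sum>c<q. degree (R l c)"]) auto
    finally show ?thesis .
  qed
  \<comment> \<open>A combination of the columns \<open>R l\<close> with coefficients of degree at
    most \<open>d\<close> has degree at most \<open>d + \<rho>\<close>, hence below
    \<open>K\<close>.\<close>
  define K where "K = Suc (d + \<rho>)"
  \<comment> \<open>The bound is \<open>max K k\<close>: the terms removed in the induction have
    degree below \<open>k\<close>, and the solution for the remainder has degree below
    \<open>K\<close>.\<close>
  have main: "\<exists>p. (\<forall>c<q. \<forall>j\<ge>max K k. coeff (p c) j = 0) \<and> (\<forall>s<m. mult_col p s = f s)"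
    if "\<forall>s<m. \<forall>i\<ge>k + rdeg s. coeff (f s) i = 0" for k f
    using that
  proof (induction k arbitrary: f)
    case 0
    define p where "p c = (\<Sum>l<m. f l * R l c)" for c
    have "mult_col p s = f s" if "s < m" for s
    proof -
      have "mult_col p s = (\<Sum>l<m. f l * mult_col (R l) s)"
        unfolding p_def mult_col_sum mult_col_smult ..
      also have "\<dots> = (\<Sum>l<m. if l = s then f l else 0)"
        using R that unfolding right_inverse_def by (intro sum.cong) auto
      finally show ?thesis using that by simp
    qed
    moreover have "coeff (p c) j = 0" if c: "c < q" and j: "max K 0 \<le> j" for c j
    proof -
      have "degree (f l * R l c) \<le> d + \<rho>" if l: "l < m" for l
      proof -
        have "degree (f l) \<le> rdeg l" using 0 l by (intro Polynomial.degree_le) auto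
        then show ?thesis
          using degree_mult_le[of "f l" "R l c"] \<rho>[OF l c] rdeg_le[OF l] by linarith
      qed
      then have "degree (p c) \<le> d + \<rho>" unfolding p_def by (intro degree_sum_le) auto
      then show ?thesis using j by (intro coeff_eq_0) (simp add: K_def)
    qed
    ultimately show ?case by blast
  next
    case (Suc k)
    obtain v where v: "\<And>s. s < m \<Longrightarrow>
        (\<Sum>c<q. coeff (M $$ (s, c)) (rdeg s) * v c) = coeff (f s) (k + rdeg s)"
      using hr_surj[OF rank, of "\<lambda>s. coeff (f s) (k + rdeg s)"] by blast
    \<comment> \<open>With \<open>v\<close> a preimage of the top coefficients of \<open>f\<close>,
      entry \<open>s\<close> of \<open>M t\<close> agrees with \<open>f s\<close> at degree
      \<open>k + rdeg s\<close> and has no higher terms.\<close>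
    define t where "t c = monom (v c) k" for c
    have t: "coeff (mult_col t s) i = (if i = k + rdeg s then coeff (f s) i else 0)"
      if s: "s < m" and i: "k + rdeg s \<le> i" for s i
    proof -
      have "coeff (M $$ (s, c) * t c) i
          = (if i = k + rdeg s then coeff (M $$ (s, c)) (rdeg s) * v c else 0)" if "c < q" for c
      proof -
        have eq: "M $$ (s, c) * t c = monom (v c) k * M $$ (s, c)"
          unfolding t_def by (rule mult.commute)
        show ?thesis unfolding eq
          using i s that by (auto simp: coeff_monom_mult coeff_above_rdeg)
      qed
      then have "coeff (mult_col t s) i
          = (\<Sum>c<q. if i = k + rdeg s then coeff (M $$ (s, c)) (rdeg s) * v c else 0)"
        unfolding mult_col_def coeff_sum by (intro sum.cong) auto
      then show ?thesis using v[OF s] by auto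
    qed
    define f' where "f' s = f s - mult_col t s" for s
    have "coeff (f' s) i = 0" if "s < m" "k + rdeg s \<le> i" for s i
      using t[OF that] Suc.prems that by (auto simp: f'_def)
    then obtain p where p: "\<And>c j. c < q \<Longrightarrow> max K k \<le> j \<Longrightarrow> coeff (p c) j = 0"
      "\<And>s. s < m \<Longrightarrow> mult_col p s = f' s" using Suc.IH[of f'] by blast
    have "coeff (p c + t c) j = 0" if "c < q" "max K (Suc k) \<le> j" for c j
      using p(1)[of c j] that by (auto simp: t_def)
    moreover have "mult_col (\<lambda>c. p c + t c) s = f s" if "s < m" for s
      using p(2)[OF that] by (simp add: mult_col_add f'_def)
    ultimately show ?case by (intro exI[of _ "\<lambda>c. p c + t c"]) simp
  qed
  have "full_image k" if "K \<le> k" for k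
    unfolding full_image_def using main[of k] that by (simp add: max_absorb2)
  then show ?thesis by blast
qed

text \<open>Let \<open>D\<close> be the largest \<open>degree (t s) + rdeg s\<close> with
  \<open>t s \<noteq> 0\<close>. The coefficient of \<open>\<lambda>^D\<close> in \<open>t M\<close>
  is a combination of the rows of the highest row degree matrix, nontrivial at an index attaining
  \<open>D\<close>, so it is nonzero. Thus \<open>w\<close> has degree at least \<open>D\<close>,
  and \<open>D\<close> is at least \<open>rdeg l\<close>.\<close>

lemma predictable_degree:
  assumes rank: "mat_rank (highest_row_degree_mat M) = m"
    and w: "w \<in> carrier_vec q" "\<And>c. c < q \<Longrightarrow> w $ c = mult_row t c" and l: "l < m" "t l \<noteq> 0"
  shows "rdeg l \<le> vec_degree w"
proof -
  define I where "I = {l. l < m \<and> t l \<noteq> 0}"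
  define D where "D = Max ((\<lambda>l. degree (t l) + rdeg l) ` I)"
  have I: "finite I" "I \<noteq> {}" using l by (auto simp: I_def)
  have D: "degree (t i) + rdeg i \<le> D" if "i \<in> I" for i
    unfolding D_def using I that by (intro Max_ge) auto
  have "D \<in> (\<lambda>l. degree (t l) + rdeg l) ` I"
    unfolding D_def using I by (intro Max_in) auto
  then obtain i where i: "i \<in> I" "degree (t i) + rdeg i = D" by blast
  have coeff: "coeff (mult_row t c) D = (\<Sum>s<m. coeff (t s) (D - rdeg s) * coeff (M $$ (s, c)) (rdeg s))"
    if c: "c < q" for c
  proof -
    have "coeff (t s * M $$ (s, c)) D = coeff (t s) (D - rdeg s) * coeff (M $$ (s, c)) (rdeg s)"
      if s: "s < m" for s
    \<comment> \<open>For \<open>t s = 0\<close> the difference \<open>D - rdeg s\<close> may be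
      truncated, but both sides are 0.\<close>
    proof (cases "t s = 0")
      case False
      then have "degree (t s) + rdeg s \<le> D" using D s by (simp add: I_def)
      then show ?thesis
        using coeff_mult_degree_bound[of "t s" "D - rdeg s" "M $$ (s, c)" "rdeg s"]
          degree_le_rdeg[OF s c] by simp
    qed simp
    then show ?thesis unfolding mult_row_def coeff_sum by (intro sum.cong) auto
  qed
  have "\<exists>c<q. coeff (mult_row t c) D \<noteq> 0"
  proof (rule ccontr)
    assume *: "\<not> ?thesis"
    have "coeff (t i) (D - rdeg i) = 0"
    proof (rule hr_indep[OF rank, where a = "\<lambda>s. coeff (t s) (D - rdeg s)"])
      show "(\<Sum>s<m. coeff (t s) (D - rdeg s) * coeff (M $$ (s, c)) (rdeg s)) = 0" if "c < q" for c
        using coeff[OF that] * that by simp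
    qed (use i(1) in \<open>simp add: I_def\<close>)
    then have "lead_coeff (t i) = 0" using i(2) by (metis add_diff_cancel_right')
    then show False using i(1) by (simp add: I_def)
  qed
  then obtain c where c: "c < q" "coeff (w $ c) D \<noteq> 0" using w(2) by auto
  have "rdeg l \<le> D" using D[of l] l by (simp add: I_def)
  also have "D \<le> degree (w $ c)" using c(2) by (rule le_degree)
  also have "\<dots> \<le> vec_degree w" using degree_le_vec_degree[of c w] c(1) w(1) by simp
  finally show ?thesis .
qed

lemma minimal_basis_matI:
  assumes "m < q" and rank: "mat_rank (highest_row_degree_mat M) = m" and R: "right_inverse m R"
  shows "minimal_basis_mat M"
proof -
  \<comment> \<open>The right inverse reads the coefficients \<open>b\<close> off from
    \<open>b M\<close>.\<close>
  have mult_R: "(\<Sum>c<q. mult_row b c * R l c) = b l" if "l < m" for b l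
  proof -
    have "(\<Sum>c<q. mult_row b c * R l c) = (\<Sum>s<m. b s * mult_col (R l) s)"
      unfolding mult_row_def mult_col_def
      by (simp add: sum_distrib_left sum_distrib_right mult.assoc sum.swap[of _ "{..<m}"])
    also have "\<dots> = (\<Sum>s<m. if s = l then b s else 0)"
      using R that unfolding right_inverse_def by (intro sum.cong) auto
    finally show ?thesis using that by simp
  qed
  have indep: row_indep
    unfolding row_indep_def
  proof (intro allI impI)
    fix b s assume "\<forall>c<q. mult_row b c = 0" and s: "s < m"
    then show "b s = 0" using mult_R[OF s, of b] by simp
  qed
  let ?W = "LinearCombinations.module.span class_ring
      (module_vec TYPE('a poly fract) q) (map_vec to_fract ` set (rows M))"
  have vsW: "vectorspace class_ring (module_vec TYPE('a poly fract) q\<lparr>carrier := ?W\<rparr>)"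
  proof -
    interpret vec_space "TYPE('a poly fract)" q .
    have "map_vec to_fract ` set (rows M) \<subseteq> carrier_vec q" using rows_carrier by auto
    then show ?thesis using span_is_subspace subspace_is_vs by simp
  qed
  have rows_basis: "polynomial_basis q ?W (rows M)"
    unfolding polynomial_basis_span_iff[OF rows_carrier] poly_indep_rows
    using rows_carrier indep in_fract_span_nth by (metis in_set_conv_nth)
  have "(\<Sum>s<m. rdeg s) \<le> sum_list (map vec_degree ws)" if basis: "polynomial_basis q ?W ws" for ws
  proof -
    have len: "length ws = m"
      using polynomial_basis_length[OF basis rows_basis vsW] M by simp
    note ws = basis[unfolded polynomial_basis_span_iff[OF rows_carrier]]
    have wsc: "ws ! i \<in> carrier_vec q" if "i < m" for i using ws that len by auto
    \<comment> \<open>If \<open>ws ! i\<close> is \<open>T M\<close>, then multiplying by the right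
      inverse shows that \<open>T\<close> must be this.\<close>
    define T where "T i l = (\<Sum>c<q. ws ! i $ c * R l c)" for i l
    have T: "ws ! i $ c = mult_row (T i) c" if i: "i < m" and c: "c < q" for i c
    proof -
      obtain g b where g: "g \<noteq> 0" "\<And>c. c < q \<Longrightarrow> g * ws ! i $ c = mult_row b c"
        using ws i len nth_mem unfolding in_fract_span_rows by metis
      have gT: "g * T i l = b l" if "l < m" for l
      proof -
        have "g * T i l = (\<Sum>c<q. mult_row b c * R l c)"
          unfolding T_def by (simp add: sum_distrib_left mult.assoc[symmetric] g(2))
        then show ?thesis using mult_R[OF that] by simp
      qed
      \<comment> \<open>From \<open>g T = b\<close> follows \<open>g T M = b M\<close>, which is
        \<open>g\<close> times \<open>ws ! i\<close>; cancelling \<open>g\<close> leaves the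
        claim.\<close>
      have "g * mult_row (T i) c = mult_row b c"
        unfolding mult_row_def by (simp add: sum_distrib_left mult.assoc[symmetric] gT)
      then show ?thesis using g c by (metis mult_left_cancel)
    qed
    define A where "A = mat m m (\<lambda>(i, l). T i l)"
    have A: "A \<in> carrier_mat m m" by (simp add: A_def)
    \<comment> \<open>A vector in the left kernel of \<open>A\<close> would be a polynomial relation
      among the \<open>ws ! i\<close>.\<close>
    have "det A \<noteq> 0"
    proof
      assume "det A = 0"
      then have "det (transpose_mat A) = 0" using det_transpose[OF A] by simp
      then obtain v where v: "v \<in> carrier_vec m" "v \<noteq> 0\<^sub>v m" "transpose_mat A *\<^sub>v v = 0\<^sub>v m"
        using det_0_iff_vec_prod_zero[of "transpose_mat A" m] A by auto
      have vT: "(\<Sum>i<m. v $ i * T i l) = 0" if "l < m" for l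
      proof -
        have "(transpose_mat A *\<^sub>v v) $ l = (\<Sum>i<m. v $ i * T i l)"
          using that v(1) by (auto simp: A_def scalar_prod_def lessThan_atLeast0 mult.commute
              intro!: sum.cong)
        then show ?thesis using v(3) that by simp
      qed
      have "(\<Sum>i<length ws. v $ i * ws ! i $ c) = 0" if c: "c < q" for c
      proof -
        have "(\<Sum>i<m. v $ i * ws ! i $ c) = (\<Sum>i<m. v $ i * (\<Sum>l<m. T i l * M $$ (l, c)))"
          using T c by (intro sum.cong) (auto simp: mult_row_def)
        also have "\<dots> = (\<Sum>l<m. (\<Sum>i<m. v $ i * T i l) * M $$ (l, c))"
          unfolding sum_distrib_left sum_distrib_right mult.assoc by (rule sum.swap)
        finally show ?thesis using vT len by simp
      qed
      then have "\<forall>i<m. v $ i = 0" using ws len unfolding poly_indep_def by blast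
      then show False using v(1,2) by auto
    qed
    then obtain \<pi> where \<pi>: "\<pi> permutes {0..<m}" "\<And>i. i < m \<Longrightarrow> A $$ (i, \<pi> i) \<noteq> 0"
      using det_nonzero_permutation[OF A] by blast
    \<comment> \<open>Along \<open>\<pi>\<close> the degree sums are compared term by term, since
      \<open>T i (\<pi> i) \<noteq> 0\<close>.\<close>
    have "(\<Sum>s<m. rdeg s) = (\<Sum>i<m. rdeg (\<pi> i))"
      using sum.permute[OF \<pi>(1), of rdeg] by (simp add: lessThan_atLeast0 o_def)
    also have "\<dots> \<le> (\<Sum>i<m. vec_degree (ws ! i))"
    proof (intro sum_mono)
      fix i assume "i \<in> {..<m}"
      then have i: "i < m" by simp
      then have "\<pi> i < m" using permutes_in_image[OF \<pi>(1), of i] by simp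
      then show "rdeg (\<pi> i) \<le> vec_degree (ws ! i)"
        using \<pi>(2)[OF i] i T[OF i] by (intro predictable_degree[OF rank wsc[OF i], of "T i"])
          (auto simp: A_def)
    qed
    also have "\<dots> = sum_list (map vec_degree ws)"
      using len by (simp add: sum_list_sum_nth lessThan_atLeast0)
    finally show ?thesis .
  qed
  then show ?thesis
    unfolding minimal_basis_mat_alt using \<open>m < q\<close> indep polynomial_basis_span_iff[OF rows_carrier]
    by blast
qed

text \<open>The rank is maximal at \<open>K\<close> and \<open>Suc K\<close>, so it grows by
  \<open>m\<close> there and the nullity by \<open>n\<close>; hence \<open>d'\<close> is a true
  minimum and at most \<open>K\<close>. Between \<open>d'\<close> and \<open>K\<close> the nullity
  grows by \<open>n\<close> per step, so the rank grows by \<open>m\<close>, and the rank formula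
  carries back from \<open>K\<close> to \<open>d'\<close>.\<close>

lemma minimal_sylvester_rank:
  assumes min: "minimal_basis_mat M" and q: "q = m + n"
  defines "\<nu> \<equiv> sylvester_nullity d M"
  defines "d' \<equiv> LEAST k. \<nu> (Suc k) = \<nu> k + n"
  shows "\<nu> (Suc d') = \<nu> d' + n" "sylvester_rank d M d' = d' * m + (\<Sum>s<m. rdeg s)"
proof -
  note total = sylvester_rank_add_nullity[folded \<nu>_def]
  obtain R where "right_inverse m R" using minimal_right_inverse[OF min] by blast
  then obtain K where K: "\<And>k. K \<le> k \<Longrightarrow> full_image k"
    using full_image_large[OF minimal_rank_hr[OF min]] by blast
  have r: "sylvester_rank d M k = k * m + (\<Sum>s<m. rdeg s)" if "K \<le> k" for k
    using K[OF that] by (simp add: sylvester_rank_eq_iff)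
  have incr: "\<nu> (Suc K) = \<nu> K + n"
    using r[of K] r[of "Suc K"] total[of K] total[of "Suc K"] q by (simp add: algebra_simps)
  show d': "\<nu> (Suc d') = \<nu> d' + n" unfolding d'_def by (rule LeastI[of _ K], rule incr)
  have "d' \<le> K" unfolding d'_def by (rule Least_le, rule incr)
  then obtain e where e: "K = d' + e" using le_Suc_ex by blast
  have "\<nu> K = \<nu> d' + e * n"
    using sylvester_nullity_linear[of d' K n] d' incr e by (simp add: \<nu>_def)
  then show "sylvester_rank d M d' = d' * m + (\<Sum>s<m. rdeg s)"
    using r[of K] total[of K] total[of d'] q e by (simp add: algebra_simps)
qed

text \<open>The increment carries the full image from \<open>k\<close> to \<open>Suc k\<close>.
  There constant targets obey the degree bound even if \<open>k\<close> and \<open>rdeg s\<close>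
  are 0, so the unit vectors have preimages, and these are the columns of a right inverse.\<close>

lemma minimal_if_sylvester_rank:
  assumes rank: "mat_rank (highest_row_degree_mat M) = m" and q: "q = m + n" and "n > 0"
    and incr: "sylvester_rank d M (Suc k) = sylvester_rank d M k + m"
    and r: "sylvester_rank d M k = k * m + (\<Sum>s<m. rdeg s)"
  shows "minimal_basis_mat M"
proof -
  have full: "full_image (Suc k)"
    unfolding sylvester_rank_eq_iff[symmetric] using incr r by simp
  have "\<exists>p. \<forall>s<m. mult_col p s = (if s = l then 1 else 0)" for l
  proof -
    have "\<forall>s<m. \<forall>i\<ge>Suc k + rdeg s. coeff (if s = l then 1 else 0) i = 0" by simp
    note ex = mp[OF spec[OF full[unfolded full_image_def], of "\<lambda>s. if s = l then 1 else 0"] this]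
    from ex obtain p where "\<forall>s<m. mult_col p s = (if s = l then 1 else 0)" by (elim exE conjE)
    then show ?thesis by (rule exI[of _ p])
  qed
  then obtain R where "\<And>l s. s < m \<Longrightarrow> mult_col (R l) s = (if s = l then 1 else 0)" by metis
  then have "right_inverse m R" unfolding right_inverse_def by simp
  then show ?thesis using minimal_basis_matI[OF _ rank] q \<open>n > 0\<close> by simp
qed

end

text \<open>\<open>LEAST\<close> has an unspecified value if no index qualifies, so the increment at
  \<open>d'\<close> is demanded explicitly. The difference is taken in the integers to avoid
  truncation.\<close>

theorem theorem3p7:
  fixes M :: "'a::field poly mat" and m n d :: nat and r \<nu> :: "nat \<Rightarrow> nat"
  assumes "m > 0" and "n > 0" and "d > 0"
    and "M \<in> carrier_mat m (m + n)"
    and "\<forall>i<m. \<forall>j<m + n. degree (M $$ (i, j)) \<le> d"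
  defines "r \<equiv> sylvester_rank d M" and "\<nu> \<equiv> sylvester_nullity d M"
  shows "(\<forall>k. \<nu> (k + 1) = \<nu> k + n \<longleftrightarrow> r (k + 1) = r k + m) \<and>
    (minimal_basis_mat M \<longleftrightarrow>
       mat_rank (highest_row_degree_mat M) = m \<and>
       (\<exists>d'. d' = (LEAST k. \<nu> (k + 1) = \<nu> k + n) \<and>
             \<nu> (d' + 1) = \<nu> d' + n \<and>
             int (r d') - int (m * d') = int (\<Sum>i<m. row_degree M i)))"
proof -
  interpret poly_mat M m "m + n" d
    using assms(4,5) by unfold_locales auto
  have total: "r k + \<nu> k = k * (m + n)" for k
    unfolding r_def \<nu>_def by (rule sylvester_rank_add_nullity)
  \<comment> \<open>Rank and nullity add up to \<open>k * (m + n)\<close>, so their increments add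
    up to \<open>m + n\<close>.\<close>
  have iff: "\<nu> (k + 1) = \<nu> k + n \<longleftrightarrow> r (k + 1) = r k + m" for k
    using total[of k] total[of "k + 1"] by (auto simp: algebra_simps)
  have int_iff: "int (r k) - int (m * k) = int (\<Sum>i<m. row_degree M i) \<longleftrightarrow>
      r k = k * m + (\<Sum>i<m. row_degree M i)" for k
  proof -
    have "int a - int b = int c \<longleftrightarrow> a = b + c" for a b c by linarith
    then show ?thesis by (simp only: mult.commute[of m k])
  qed
  show ?thesis
    unfolding int_iff
  proof (intro conjI)
    show "\<forall>k. \<nu> (k + 1) = \<nu> k + n \<longleftrightarrow> r (k + 1) = r k + m" using iff by blast
  next
    show "minimal_basis_mat M \<longleftrightarrow> mat_rank (highest_row_degree_mat M) = m \<and>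
      (\<exists>d'. d' = (LEAST k. \<nu> (k + 1) = \<nu> k + n) \<and> \<nu> (d' + 1) = \<nu> d' + n \<and>
        r d' = d' * m + (\<Sum>i<m. row_degree M i))"
    proof (intro iffI conjI)
      assume "minimal_basis_mat M"
      then show "mat_rank (highest_row_degree_mat M) = m"
        and "\<exists>d'. d' = (LEAST k. \<nu> (k + 1) = \<nu> k + n) \<and> \<nu> (d' + 1) = \<nu> d' + n \<and>
          r d' = d' * m + (\<Sum>i<m. row_degree M i)"
        using minimal_rank_hr minimal_sylvester_rank[OF _ refl] by (simp_all add: r_def \<nu>_def)
    next
      assume "mat_rank (highest_row_degree_mat M) = m \<and>
        (\<exists>d'. d' = (LEAST k. \<nu> (k + 1) = \<nu> k + n) \<and> \<nu> (d' + 1) = \<nu> d' + n \<and>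
          r d' = d' * m + (\<Sum>i<m. row_degree M i))"
      then show "minimal_basis_mat M"
        using minimal_if_sylvester_rank[OF _ refl assms(2)] iff by (auto simp: r_def)
    qed
  qed
qed

end
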